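(* Let $A$ be a commutative $\Bbbk$-algebra. Given an $A$-ring $R$ and the canonical map $\xi:R^\bullet\to R^*$, the kernel $\ker(\xi)$ contains no non-zero coideals of $R^\bullet$. In particular, $\xi$ is injective if and only if $\ker(\xi)$ is a coideal of $R^\bullet$.
   Context: $\Bbbk$ is a field. An $A$-ring is a $\Bbbk$-algebra $R$ with an algebra map $A\to R$ (image not necessarily central). $R^*=\mathrm{Hom}_{-A}(R,A)$ is the set of right $A$-linear maps, with $A$-bimodule structure $(afb)(r)=af(br)$. An $A$-coring is an $A$-bimodule $C$ with $A$-bilinear coassociative $\Delta:C\to C\otimes_AC$, $c\mapsto c_1\otimes_Ac_2$, and $A$-bilinear counit $\varepsilon:C\to A$; coring maps are $A$-bilinear maps compatible with $\Delta,\varepsilon$. A coideal of an $A$-coring $C$ is an $A$-subbimodule $\mathcal J$ such that the quotient $C/\mathcal J$ is an $A$-coring and the canonical projection $C\to C/\mathcal J$ is an $A$-coring map. For an $A$-bimodule map $f:C\to R^*$ from an $A$-coring $C$ consider the relations $( * )$ $f(z)(xy)=f(z_1)(f(z_2)(x)y)$, $f(z)(1_R)=\varepsilon(z)$, $f(azb)(x)=af(z)(bx)$, for $z\in C$, $x,y\in R$, $a,b\in A$. $R^\bullet$ is the $A$-coring (existing by the Special Adjoint Functor Theorem) endowed with an $A$-bimodule map $\xi:R^\bullet\to R^*$ satisfying $( * )$ and universal: for each $A$-coring $C$ and each $A$-bimodule map $f:C\to R^*$ satisfying $( * )$ there is a unique $A$-coring map $\hat f:C\to R^\bullet$ with $\xi\circ\hat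 f=f$. *)

theory Defs
  imports "HOL-Algebra.Algebra"
begin

section \<open>Algebras and rings over a base algebra\<close>

text \<open>The library locale \<^locale>\<open>algebra\<close> is about commutative algebras; the following is its
  noncommutative analogue.\<close>

locale assoc_algebra = module K S + S: ring S for K and S (structure) +
  assumes smult_mult_left:
      "\<lbrakk>k \<in> carrier K; x \<in> carrier S; y \<in> carrier S\<rbrakk> \<Longrightarrow> (k \<odot> x) \<otimes> y = k \<odot> (x \<otimes> y)"
    and smult_mult_right:
      "\<lbrakk>k \<in> carrier K; x \<in> carrier S; y \<in> carrier S\<rbrakk> \<Longrightarrow> x \<otimes> (k \<odot> y) = k \<odot> (x \<otimes> y)"

locale A_ring = A: algebra K A + B: assoc_algebra K R
  for K :: "('k, 'm) ring_scheme" and A :: "('k, 'a, 'n) module_scheme"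
    and R :: "('k, 'r, 'o) module_scheme" and \<iota> :: "'a \<Rightarrow> 'r" +
  assumes ring_hom: "\<iota> \<in> ring_hom A R"
    and smult_hom: "\<lbrakk>k \<in> carrier K; a \<in> carrier A\<rbrakk> \<Longrightarrow> \<iota> (k \<odot>\<^bsub>A\<^esub> a) = k \<odot>\<^bsub>R\<^esub> \<iota> a"


section \<open>Bimodules\<close>

text \<open>As for \<^type>\<open>module_scheme\<close>, the fields for multiplication and unit are present but
  irrelevant for bimodules.\<close>

record ('a, 'b) bimodule = "('a, 'b) module" +
  rsmult :: "'b \<Rightarrow> 'a \<Rightarrow> 'b" (infixl \<open>\<triangleleft>\<index>\<close> 70)

text \<open>Bimodules over a \<open>K\<close>-algebra are \<open>K\<close>-central: the two induced actions of \<open>K\<close> agree.\<close>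

locale bimodule = A: algebra K A + module A M
  for K :: "('k, 'm) ring_scheme" and A :: "('k, 'a, 'n) module_scheme"
    and M :: "('a, 'b, 'o) bimodule_scheme" (structure) +
  assumes rsmult_closed: "\<lbrakk>x \<in> carrier M; a \<in> carrier A\<rbrakk> \<Longrightarrow> x \<triangleleft> a \<in> carrier M"
    and rsmult_l_distr:
      "\<lbrakk>x \<in> carrier M; y \<in> carrier M; a \<in> carrier A\<rbrakk> \<Longrightarrow> (x \<oplus> y) \<triangleleft> a = x \<triangleleft> a \<oplus> y \<triangleleft> a"
    and rsmult_r_distr:
      "\<lbrakk>x \<in> carrier M; a \<in> carrier A; b \<in> carrier A\<rbrakk> \<Longrightarrow> x \<triangleleft> (a \<oplus>\<^bsub>A\<^esub> b) = x \<triangleleft> a \<oplus> x \<triangleleft> b"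
    and rsmult_assoc:
      "\<lbrakk>x \<in> carrier M; a \<in> carrier A; b \<in> carrier A\<rbrakk> \<Longrightarrow> x \<triangleleft> (a \<otimes>\<^bsub>A\<^esub> b) = x \<triangleleft> a \<triangleleft> b"
    and rsmult_one: "x \<in> carrier M \<Longrightarrow> x \<triangleleft> \<one>\<^bsub>A\<^esub> = x"
    and smult_rsmult:
      "\<lbrakk>a \<in> carrier A; x \<in> carrier M; b \<in> carrier A\<rbrakk> \<Longrightarrow> (a \<odot> x) \<triangleleft> b = a \<odot> (x \<triangleleft> b)"
    and central:
      "\<lbrakk>k \<in> carrier K; x \<in> carrier M\<rbrakk> \<Longrightarrow> (k \<odot>\<^bsub>A\<^esub> \<one>\<^bsub>A\<^esub>) \<odot> x = x \<triangleleft> (k \<odot>\<^bsub>A\<^esub> \<one>\<^bsub>A\<^esub>)"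

definition bimodule_hom ::
  "('k, 'a, 'n) module_scheme \<Rightarrow> ('a, 'b, 'o) bimodule_scheme \<Rightarrow> ('a, 'c, 'p) bimodule_scheme
    \<Rightarrow> ('b \<Rightarrow> 'c) set"
  where "bimodule_hom A M N = {f \<in> carrier M \<rightarrow> carrier N.
    (\<forall>x \<in> carrier M. \<forall>y \<in> carrier M. f (x \<oplus>\<^bsub>M\<^esub> y) = f x \<oplus>\<^bsub>N\<^esub> f y) \<and>
    (\<forall>a \<in> carrier A. \<forall>x \<in> carrier M. f (a \<odot>\<^bsub>M\<^esub> x) = a \<odot>\<^bsub>N\<^esub> f x) \<and>
    (\<forall>a \<in> carrier A. \<forall>x \<in> carrier M. f (x \<triangleleft>\<^bsub>M\<^esub> a) = f x \<triangleleft>\<^bsub>N\<^esub> a)}"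

definition regular_bimodule :: "('k, 'a, 'n) module_scheme \<Rightarrow> ('a, 'a) bimodule"
  where "regular_bimodule A = \<lparr>carrier = carrier A, monoid.mult = monoid.mult A, one = \<one>\<^bsub>A\<^esub>,
    ring.zero = \<zero>\<^bsub>A\<^esub>, ring.add = ring.add A,
    smult = monoid.mult A, rsmult = monoid.mult A\<rparr>"

definition subbimodule ::
  "('k, 'a, 'n) module_scheme \<Rightarrow> ('a, 'b, 'o) bimodule_scheme \<Rightarrow> 'b set \<Rightarrow> bool"
  where "subbimodule A M J \<longleftrightarrow>
    submodule J A M \<and> (\<forall>x \<in> J. \<forall>a \<in> carrier A. x \<triangleleft>\<^bsub>M\<^esub> a \<in> J)"

definition quotient_bimodule ::
  "('a, 'b, 'o) bimodule_scheme \<Rightarrow> 'b set \<Rightarrow> ('a, 'b set) bimodule"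
  where "quotient_bimodule M J = \<lparr>carrier = a_rcosets\<^bsub>M\<^esub> J, monoid.mult = undefined, one = undefined,
    ring.zero = J, ring.add = set_add M,
    smult = (\<lambda>a S. \<Union>x\<in>S. J +>\<^bsub>M\<^esub> (a \<odot>\<^bsub>M\<^esub> x)),
    rsmult = (\<lambda>S a. \<Union>x\<in>S. J +>\<^bsub>M\<^esub> (x \<triangleleft>\<^bsub>M\<^esub> a))\<rparr>"

section \<open>Tensor products of bimodules\<close>

text \<open>\<open>M \<otimes>\<^sub>A N\<close> is the free abelian group on \<open>carrier M \<times> carrier N\<close> modulo the subgroup generated
  by biadditivity and \<open>A\<close>-balancedness.
  The group is the library quotient \<^term>\<open>G Mod H\<close>, rewritten additively.\<close>

type_synonym ('b, 'c) tens = "('b \<times> 'c \<Rightarrow>\<^sub>0 int) set"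

definition tensor_relations ::
  "('k, 'a, 'n) module_scheme \<Rightarrow> ('a, 'b, 'o) bimodule_scheme \<Rightarrow> ('a, 'c, 'p) bimodule_scheme
    \<Rightarrow> ('b, 'c) tens"
  where "tensor_relations A M N =
    generate (free_Abelian_group (carrier M \<times> carrier N))
     ({frag_of (x \<oplus>\<^bsub>M\<^esub> x', y) - frag_of (x, y) - frag_of (x', y) | x x' y.
         x \<in> carrier M \<and> x' \<in> carrier M \<and> y \<in> carrier N} \<union>
      {frag_of (x, y \<oplus>\<^bsub>N\<^esub> y') - frag_of (x, y) - frag_of (x, y') | x y y'.
         x \<in> carrier M \<and> y \<in> carrier N \<and> y' \<in> carrier N} \<union>
      {frag_of (x \<triangleleft>\<^bsub>M\<^esub> a, y) - frag_of (x, a \<odot>\<^bsub>N\<^esub> y) | x a y.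
         x \<in> carrier M \<and> a \<in> carrier A \<and> y \<in> carrier N})"

definition pure_tensor ::
  "('k, 'a, 'n) module_scheme \<Rightarrow> ('a, 'b, 'o) bimodule_scheme \<Rightarrow> ('a, 'c, 'p) bimodule_scheme
    \<Rightarrow> 'b \<Rightarrow> 'c \<Rightarrow> ('b, 'c) tens"
  where "pure_tensor A M N x y =
    tensor_relations A M N #>\<^bsub>free_Abelian_group (carrier M \<times> carrier N)\<^esub> frag_of (x, y)"

definition tensor_group ::
  "('k, 'a, 'n) module_scheme \<Rightarrow> ('a, 'b, 'o) bimodule_scheme \<Rightarrow> ('a, 'c, 'p) bimodule_scheme
    \<Rightarrow> ('b, 'c) tens ring"
  where "tensor_group A M N =
    (let Q = free_Abelian_group (carrier M \<times> carrier N) Mod tensor_relations A M N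
     in \<lparr>carrier = carrier Q, monoid.mult = undefined, one = undefined,
         ring.zero = \<one>\<^bsub>Q\<^esub>, ring.add = monoid.mult Q\<rparr>)"

text \<open>For a biadditive balanced map \<open>\<phi>\<close> into an abelian group \<open>G\<close>, \<open>tensor_lift G \<phi>\<close> is the induced
  additive map: it sends \<open>\<Sum>\<^sub>i x\<^sub>i \<otimes> y\<^sub>i\<close> to \<open>\<Sum>\<^sub>i \<phi> x\<^sub>i y\<^sub>i\<close>. The chosen representative does not matter in
  that case; all uses below are of this kind.\<close>

definition tensor_lift ::
  "('g, 'q) ring_scheme \<Rightarrow> ('b \<Rightarrow> 'c \<Rightarrow> 'g) \<Rightarrow> ('b, 'c) tens \<Rightarrow> 'g"
  where "tensor_lift G \<phi> t = (let u = (SOME u. u \<in> t) in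
    \<Oplus>\<^bsub>G\<^esub>p \<in> Poly_Mapping.keys u. [Poly_Mapping.lookup u p] \<cdot>\<^bsub>G\<^esub> \<phi> (fst p) (snd p))"

definition tensor ::
  "('k, 'a, 'n) module_scheme \<Rightarrow> ('a, 'b, 'o) bimodule_scheme \<Rightarrow> ('a, 'c, 'p) bimodule_scheme
    \<Rightarrow> ('a, ('b, 'c) tens) bimodule"
  where "tensor A M N =
    (let T = tensor_group A M N in
     \<lparr>carrier = carrier T, monoid.mult = undefined, one = undefined,
      ring.zero = \<zero>\<^bsub>T\<^esub>, ring.add = ring.add T,
      smult = (\<lambda>a. tensor_lift T (\<lambda>x y. pure_tensor A M N (a \<odot>\<^bsub>M\<^esub> x) y)),
      rsmult = (\<lambda>t a. tensor_lift T (\<lambda>x y. pure_tensor A M N x (y \<triangleleft>\<^bsub>N\<^esub> a)) t)\<rparr>)"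

text \<open>\<open>f \<otimes>\<^sub>A g : M \<otimes>\<^sub>A N \<rightarrow> M' \<otimes>\<^sub>A N'\<close>; only the target modules are needed as arguments.\<close>

definition tensor_map ::
  "('k, 'a, 'n) module_scheme \<Rightarrow> ('a, 'd, 'o) bimodule_scheme \<Rightarrow> ('a, 'e, 'p) bimodule_scheme
    \<Rightarrow> ('b \<Rightarrow> 'd) \<Rightarrow> ('c \<Rightarrow> 'e) \<Rightarrow> ('b, 'c) tens \<Rightarrow> ('d, 'e) tens"
  where "tensor_map A M' N' f g =
    tensor_lift (tensor A M' N') (\<lambda>x y. pure_tensor A M' N' (f x) (g y))"

text \<open>\<open>(M \<otimes>\<^sub>A N) \<otimes>\<^sub>A P \<rightarrow> M \<otimes>\<^sub>A (N \<otimes>\<^sub>A P)\<close>, \<open>(x \<otimes> y) \<otimes> z \<mapsto> x \<otimes> (y \<otimes> z)\<close>\<close>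

definition tensor_assoc ::
  "('k, 'a, 'n) module_scheme \<Rightarrow> ('a, 'b, 'o) bimodule_scheme \<Rightarrow> ('a, 'c, 'p) bimodule_scheme
    \<Rightarrow> ('a, 'd, 'q) bimodule_scheme \<Rightarrow> (('b, 'c) tens, 'd) tens \<Rightarrow> ('b, ('c, 'd) tens) tens"
  where "tensor_assoc A M N P =
    (let T = tensor A M (tensor A N P) in
     tensor_lift T (\<lambda>t z. tensor_lift T (\<lambda>x y.
       pure_tensor A M (tensor A N P) x (pure_tensor A N P y z)) t))"


section \<open>Corings\<close>

locale coring = bimodule K A C
  for K :: "('k, 'm) ring_scheme" and A :: "('k, 'a, 'n) module_scheme"
    and C :: "('a, 'c, 'o) bimodule_scheme" (structure)
    and \<Delta> :: "'c \<Rightarrow> ('c, 'c) tens" and \<epsilon> :: "'c \<Rightarrow> 'a" +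
  assumes comult_hom: "\<Delta> \<in> bimodule_hom A C (tensor A C C)"
    and counit_hom: "\<epsilon> \<in> bimodule_hom A C (regular_bimodule A)"
    and coassoc: "c \<in> carrier C \<Longrightarrow>
      tensor_assoc A C C C (tensor_map A (tensor A C C) C \<Delta> (\<lambda>x. x) (\<Delta> c)) =
      tensor_map A C (tensor A C C) (\<lambda>x. x) \<Delta> (\<Delta> c)"
    and counit_left: "c \<in> carrier C \<Longrightarrow> tensor_lift C (\<lambda>x y. \<epsilon> x \<odot> y) (\<Delta> c) = c"
    and counit_right: "c \<in> carrier C \<Longrightarrow> tensor_lift C (\<lambda>x y. x \<triangleleft> \<epsilon> y) (\<Delta> c) = c"

definition coring_hom ::
  "('k, 'a, 'n) module_scheme
    \<Rightarrow> ('a, 'c, 'o) bimodule_scheme \<Rightarrow> ('c \<Rightarrow> ('c, 'c) tens) \<Rightarrow> ('c \<Rightarrow> 'a)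
    \<Rightarrow> ('a, 'd, 'p) bimodule_scheme \<Rightarrow> ('d \<Rightarrow> ('d, 'd) tens) \<Rightarrow> ('d \<Rightarrow> 'a)
    \<Rightarrow> ('c \<Rightarrow> 'd) set"
  where "coring_hom A C \<Delta> \<epsilon> D \<Delta>' \<epsilon>' = {g \<in> bimodule_hom A C D.
    (\<forall>c \<in> carrier C. \<Delta>' (g c) = tensor_map A D D g g (\<Delta> c) \<and> \<epsilon>' (g c) = \<epsilon> c)}"

definition coideal ::
  "('k, 'm) ring_scheme \<Rightarrow> ('k, 'a, 'n) module_scheme
    \<Rightarrow> ('a, 'c, 'o) bimodule_scheme \<Rightarrow> ('c \<Rightarrow> ('c, 'c) tens) \<Rightarrow> ('c \<Rightarrow> 'a) \<Rightarrow> 'c set \<Rightarrow> bool"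
  where "coideal K A C \<Delta> \<epsilon> J \<longleftrightarrow> subbimodule A C J \<and>
    (\<exists>\<Delta>' \<epsilon>'. coring K A (quotient_bimodule C J) \<Delta>' \<epsilon>' \<and>
      (\<lambda>c. J +>\<^bsub>C\<^esub> c) \<in> coring_hom A C \<Delta> \<epsilon> (quotient_bimodule C J) \<Delta>' \<epsilon>')"


section \<open>The right dual of a ring over A and its finite dual coring\<close>

text \<open>\<open>R\<^sup>* = Hom\<^sub>-\<^sub>A(R, A)\<close> with \<open>(a f b)(r) = a f(b r)\<close>. Functions are extensional on \<open>carrier R\<close>, so
  that equality of elements is equality of maps.\<close>

definition right_dual ::
  "('k, 'a, 'n) module_scheme \<Rightarrow> ('k, 'r, 'o) module_scheme \<Rightarrow> ('a \<Rightarrow> 'r)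
    \<Rightarrow> ('a, 'r \<Rightarrow> 'a) bimodule"
  where "right_dual A R \<iota> =
    \<lparr>carrier = {f \<in> carrier R \<rightarrow>\<^sub>E carrier A.
       (\<forall>x \<in> carrier R. \<forall>y \<in> carrier R. f (x \<oplus>\<^bsub>R\<^esub> y) = f x \<oplus>\<^bsub>A\<^esub> f y) \<and>
       (\<forall>x \<in> carrier R. \<forall>a \<in> carrier A. f (x \<otimes>\<^bsub>R\<^esub> \<iota> a) = f x \<otimes>\<^bsub>A\<^esub> a)},
     monoid.mult = undefined, one = undefined,
     ring.zero = (\<lambda>x \<in> carrier R. \<zero>\<^bsub>A\<^esub>),
     ring.add = (\<lambda>f g. \<lambda>x \<in> carrier R. f x \<oplus>\<^bsub>A\<^esub> g x),
     smult = (\<lambda>a f. \<lambda>x \<in> carrier R. a \<otimes>\<^bsub>A\<^esub> f x),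
     rsmult = (\<lambda>f b. \<lambda>x \<in> carrier R. f (\<iota> b \<otimes>\<^bsub>R\<^esub> x))\<rparr>"

text \<open>The relations \<open>f(z)(xy) = f(z\<^sub>1)(f(z\<^sub>2)(x) y)\<close>, \<open>f(z)(1) = \<epsilon>(z)\<close> and
  \<open>f(azb)(x) = a f(z)(bx)\<close>.\<close>

definition dual_relations ::
  "('k, 'a, 'n) module_scheme \<Rightarrow> ('k, 'r, 'p) module_scheme \<Rightarrow> ('a \<Rightarrow> 'r)
    \<Rightarrow> ('a, 'c, 'o) bimodule_scheme \<Rightarrow> ('c \<Rightarrow> ('c, 'c) tens) \<Rightarrow> ('c \<Rightarrow> 'a)
    \<Rightarrow> ('c \<Rightarrow> 'r \<Rightarrow> 'a) \<Rightarrow> bool"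
  where "dual_relations A R \<iota> C \<Delta> \<epsilon> f \<longleftrightarrow> (\<forall>z \<in> carrier C.
    (\<forall>x \<in> carrier R. \<forall>y \<in> carrier R.
      f z (x \<otimes>\<^bsub>R\<^esub> y) = tensor_lift A (\<lambda>z\<^sub>1 z\<^sub>2. f z\<^sub>1 (\<iota> (f z\<^sub>2 x) \<otimes>\<^bsub>R\<^esub> y)) (\<Delta> z)) \<and>
    f z \<one>\<^bsub>R\<^esub> = \<epsilon> z \<and>
    (\<forall>a \<in> carrier A. \<forall>b \<in> carrier A. \<forall>x \<in> carrier R.
      f ((a \<odot>\<^bsub>C\<^esub> z) \<triangleleft>\<^bsub>C\<^esub> b) x = a \<otimes>\<^bsub>A\<^esub> f z (\<iota> b \<otimes>\<^bsub>R\<^esub> x)))"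

text \<open>\<open>(C, \<Delta>, \<epsilon>)\<close> with \<open>\<xi>\<close> is (a model of) \<open>R\<^sup>\<bullet>\<close>. HOL cannot quantify over all types inside a formula,
  so the test corings \<open>D\<close> range over all corings with carrier in the type \<open>'c\<close> that also houses \<open>C\<close>.
  This is implied by universality among all corings.
  The maps \<open>g\<close> are extensional on \<open>carrier D\<close> to make uniqueness meaningful.\<close>

definition finite_dual ::
  "('k, 'm) ring_scheme \<Rightarrow> ('k, 'a, 'n) module_scheme \<Rightarrow> ('k, 'r, 'p) module_scheme
    \<Rightarrow> ('a \<Rightarrow> 'r) \<Rightarrow> ('a, 'c) bimodule \<Rightarrow> ('c \<Rightarrow> ('c, 'c) tens) \<Rightarrow> ('c \<Rightarrow> 'a)
    \<Rightarrow> ('c \<Rightarrow> 'r \<Rightarrow> 'a) \<Rightarrow> bool"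
  where "finite_dual K A R \<iota> C \<Delta> \<epsilon> \<xi> \<longleftrightarrow>
    coring K A C \<Delta> \<epsilon> \<and> \<xi> \<in> bimodule_hom A C (right_dual A R \<iota>) \<and>
    dual_relations A R \<iota> C \<Delta> \<epsilon> \<xi> \<and>
    (\<forall>(D :: ('a, 'c) bimodule) \<Delta>' \<epsilon>' f.
      coring K A D \<Delta>' \<epsilon>' \<and> f \<in> bimodule_hom A D (right_dual A R \<iota>) \<and>
      dual_relations A R \<iota> D \<Delta>' \<epsilon>' f \<longrightarrow>
      (\<exists>!g. g \<in> extensional (carrier D) \<and> g \<in> coring_hom A D \<Delta>' \<epsilon>' C \<Delta> \<epsilon> \<and>
        (\<forall>z \<in> carrier D. \<xi> (g z) = f z)))"

end

theory Submission
  imports Defs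
begin

text \<open>Let \<open>J\<close> be a coideal contained in the kernel of \<open>\<xi>\<close>. The map \<open>\<xi>\<close> is constant on the
  cosets of \<open>J\<close>, so it factors through the projection \<open>\<pi> : C \<rightarrow> C/J\<close> as \<open>f \<circ> \<pi>\<close>. Since \<open>\<pi>\<close> is a
  surjective coring map, \<open>f\<close> inherits the relations of \<open>\<xi>\<close>. Universality turns \<open>f\<close> into a coring
  map \<open>g : C/J \<rightarrow> C\<close> with \<open>\<xi> \<circ> g = f\<close>. Now \<open>g \<circ> \<pi>\<close> and the identity are two coring maps \<open>C \<rightarrow> C\<close>
  lying over \<open>\<xi>\<close>, so they agree by the uniqueness half of universality. Hence \<open>\<pi>\<close> is injective and
  \<open>J\<close> is zero. For the equivalence, the zero submodule is always a coideal, and an additive map is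
  injective exactly when its kernel is zero.

  Elements of \<open>C/J\<close> are sets of elements of \<open>C\<close>, whereas universality speaks of corings on the type
  of \<open>C\<close> itself. The quotient is therefore moved onto a set of coset representatives
  (\<open>coideal_quotient_on_representatives\<close>). The composite \<open>\<rho>\<close> of \<open>\<pi>\<close> with the choice of
  representatives satisfies \<open>\<xi> (\<rho> c) = \<xi> c\<close>, so the factored map is \<open>\<xi>\<close> itself, restricted to the
  representatives.

  Both the transported quotient and the quotient by zero are obtained from one principle,
  \<open>coring_surjection\<close>: a surjective bimodule map onto \<open>D\<close> that intertwines a coring structure with
  given maps \<open>\<Delta>'\<close> and \<open>\<epsilon>'\<close> forces these to satisfy the coring axioms. Its proof moves the axioms
  along tensor powers of the map, and so rests on functoriality of \<open>\<otimes>\<^sub>A\<close> and naturality of the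
  associator. These follow from the universal property of the tensor product, which is derived
  first.\<close>


section \<open>Bimodule maps and balanced maps\<close>

lemma bimodule_homD:
  assumes "f \<in> bimodule_hom A M N"
  shows "x \<in> carrier M \<Longrightarrow> f x \<in> carrier N"
    and "\<lbrakk>x \<in> carrier M; y \<in> carrier M\<rbrakk> \<Longrightarrow> f (x \<oplus>\<^bsub>M\<^esub> y) = f x \<oplus>\<^bsub>N\<^esub> f y"
    and "\<lbrakk>a \<in> carrier A; x \<in> carrier M\<rbrakk> \<Longrightarrow> f (a \<odot>\<^bsub>M\<^esub> x) = a \<odot>\<^bsub>N\<^esub> f x"
    and "\<lbrakk>a \<in> carrier A; x \<in> carrier M\<rbrakk> \<Longrightarrow> f (x \<triangleleft>\<^bsub>M\<^esub> a) = f x \<triangleleft>\<^bsub>N\<^esub> a"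
  using assms by (auto simp: bimodule_hom_def)

lemma bimodule_homI:
  assumes "\<And>x. x \<in> carrier M \<Longrightarrow> f x \<in> carrier N"
    and "\<And>x y. \<lbrakk>x \<in> carrier M; y \<in> carrier M\<rbrakk> \<Longrightarrow> f (x \<oplus>\<^bsub>M\<^esub> y) = f x \<oplus>\<^bsub>N\<^esub> f y"
    and "\<And>a x. \<lbrakk>a \<in> carrier A; x \<in> carrier M\<rbrakk> \<Longrightarrow> f (a \<odot>\<^bsub>M\<^esub> x) = a \<odot>\<^bsub>N\<^esub> f x"
    and "\<And>a x. \<lbrakk>a \<in> carrier A; x \<in> carrier M\<rbrakk> \<Longrightarrow> f (x \<triangleleft>\<^bsub>M\<^esub> a) = f x \<triangleleft>\<^bsub>N\<^esub> a"
  shows "f \<in> bimodule_hom A M N"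
  using assms by (auto simp: bimodule_hom_def)

lemma bimodule_hom_compose:
  assumes "f \<in> bimodule_hom A M N" and "g \<in> bimodule_hom A N P"
  shows "(\<lambda>x. g (f x)) \<in> bimodule_hom A M P"
  using assms by (auto simp: bimodule_hom_def Pi_iff)

lemma bimodule_hom_id: "(\<lambda>x. x) \<in> bimodule_hom A M M"
  by (auto simp: bimodule_hom_def)

definition balanced ::
  "('k, 'a, 'n) module_scheme \<Rightarrow> ('a, 'b, 'o) bimodule_scheme \<Rightarrow> ('a, 'c, 'p) bimodule_scheme
    \<Rightarrow> ('g, 'q) ring_scheme \<Rightarrow> ('b \<Rightarrow> 'c \<Rightarrow> 'g) \<Rightarrow> bool"
  where "balanced A M N G \<phi> \<longleftrightarrow>
    (\<forall>x \<in> carrier M. \<forall>y \<in> carrier N. \<phi> x y \<in> carrier G) \<and>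
    (\<forall>x \<in> carrier M. \<forall>x' \<in> carrier M. \<forall>y \<in> carrier N.
      \<phi> (x \<oplus>\<^bsub>M\<^esub> x') y = \<phi> x y \<oplus>\<^bsub>G\<^esub> \<phi> x' y) \<and>
    (\<forall>x \<in> carrier M. \<forall>y \<in> carrier N. \<forall>y' \<in> carrier N.
      \<phi> x (y \<oplus>\<^bsub>N\<^esub> y') = \<phi> x y \<oplus>\<^bsub>G\<^esub> \<phi> x y') \<and>
    (\<forall>x \<in> carrier M. \<forall>a \<in> carrier A. \<forall>y \<in> carrier N.
      \<phi> (x \<triangleleft>\<^bsub>M\<^esub> a) y = \<phi> x (a \<odot>\<^bsub>N\<^esub> y))"

section \<open>The universal property of the tensor product\<close>

text \<open>A map induced on a tensor product is given by an explicit sum over a representative; this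
  identifies that sum with the value of a homomorphism on the free abelian group, whose dependence
  on the representative can be controlled through its kernel.\<close>

lemma hom_free_Abelian_group_expansion:
  fixes G :: "('g, 'q) ring_scheme"
  assumes G: "abelian_group G"
    and h: "h \<in> hom (free_Abelian_group S) (add_monoid G)"
    and u: "Poly_Mapping.keys u \<subseteq> S"
  shows "h u = (\<Oplus>\<^bsub>G\<^esub>p \<in> Poly_Mapping.keys u. [Poly_Mapping.lookup u p] \<cdot>\<^bsub>G\<^esub> h (frag_of p))"
proof -
  interpret G: abelian_group G by fact
  interpret h: group_hom "free_Abelian_group S" "add_monoid G" h
    using h G.a_group by (simp add: group_hom_def group_hom_axioms_def)
  have hf: "h (frag_cmul c (frag_of p)) = [c] \<cdot>\<^bsub>G\<^esub> h (frag_of p)" if "p \<in> S" for c p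
    using h.hom_int_pow[of "frag_of p" c] that by (simp add: add_pow_def)
  have hc: "h v \<in> carrier G" if "Poly_Mapping.keys v \<subseteq> S" for v
    using h.hom_closed that by simp
  have "h (\<Sum>p\<in>I. frag_cmul (c p) (frag_of p)) = (\<Oplus>\<^bsub>G\<^esub>p \<in> I. [c p] \<cdot>\<^bsub>G\<^esub> h (frag_of p))"
    if "finite I" "I \<subseteq> S" for I and c :: "_ \<Rightarrow> int"
    using that
  proof (induction I)
    case empty
    show ?case using h.hom_one by simp
  next
    case (insert p I)
    have k: "Poly_Mapping.keys (\<Sum>p\<in>I. frag_cmul (c p) (frag_of p)) \<subseteq> S"
      using sum_closed_free_Abelian_group[of I "\<lambda>p. frag_cmul (c p) (frag_of p)" S] insert.prems
      by (force simp: keys_frag_of)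
    have "h (frag_cmul (c p) (frag_of p) + (\<Sum>p\<in>I. frag_cmul (c p) (frag_of p)))
        = h (frag_cmul (c p) (frag_of p)) \<oplus>\<^bsub>G\<^esub> h (\<Sum>p\<in>I. frag_cmul (c p) (frag_of p))"
      using h.hom_mult[of "frag_cmul (c p) (frag_of p)" "\<Sum>p\<in>I. frag_cmul (c p) (frag_of p)"]
        k keys_cmul[of "c p" "frag_of p"] insert.prems by (auto simp: keys_frag_of)
    moreover have "h (frag_of q) \<in> carrier G" if "q \<in> S" for q
      using that hc by simp
    ultimately show ?case
      using insert hf by (simp add: G.finsum_insert Pi_iff subset_iff)
  qed
  from this[OF finite_keys u, of "Poly_Mapping.lookup u"] show ?thesis
    using frag_expansion[of u] by (simp add: frag_extend_def)
qed

lemma carrier_tensor: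
  "carrier (tensor A M N) =
    carrier (free_Abelian_group (carrier M \<times> carrier N) Mod tensor_relations A M N)"
  by (simp add: tensor_def tensor_group_def Let_def)

lemma abelian_group_of_comm_group:
  assumes "comm_group Q" and "carrier G = carrier Q" and "ring.add G = monoid.mult Q"
    and "\<zero>\<^bsub>G\<^esub> = \<one>\<^bsub>Q\<^esub>"
  shows "abelian_group G"
proof -
  interpret comm_group Q by fact
  show ?thesis
    by (rule abelian_groupI) (auto simp: assms(2-4) m_assoc intro: m_comm l_inv_ex)
qed

locale bimodule_pair = M: bimodule K A M + N: bimodule K A N
  for K :: "('k, 'm) ring_scheme" and A :: "('k, 'a, 'n) module_scheme"
    and M :: "('a, 'b, 'o) bimodule_scheme" and N :: "('a, 'c, 'p) bimodule_scheme"
begin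

abbreviation "FF \<equiv> free_Abelian_group (carrier M \<times> carrier N)"
abbreviation "TR \<equiv> tensor_relations A M N"
abbreviation "MN \<equiv> tensor A M N"
abbreviation "pt \<equiv> pure_tensor A M N"

sublocale F: comm_group FF
  by (rule abelian_free_Abelian_group)

lemma subgroup_relations: "subgroup TR FF"
  unfolding tensor_relations_def
  by (rule F.generate_is_subgroup)
    (auto simp: keys_frag_of M.rsmult_closed N.smult_closed
      dest!: subsetD[OF keys_diff])

lemma normal_relations: "TR \<lhd> FF"
  using subgroup_relations by (rule F.subgroup_imp_normal)

lemma comm_group_quotient: "comm_group (FF Mod TR)"
  using subgroup_relations by (rule F.abelian_FactGroup)

lemma abelian_group_tensor: "abelian_group MN"
  by (rule abelian_group_of_comm_group[OF comm_group_quotient])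
    (simp_all add: tensor_def tensor_group_def Let_def)

lemma abelian_group_tensor_group: "abelian_group (tensor_group A M N)"
  by (rule abelian_group_of_comm_group[OF comm_group_quotient])
    (simp_all add: tensor_group_def Let_def)

lemma tensor_group_simps:
  "carrier (tensor_group A M N) = carrier MN" "ring.add (tensor_group A M N) = ring.add MN"
  by (simp_all add: tensor_def Let_def)

sublocale T: abelian_group MN
  by (rule abelian_group_tensor)

lemma coset_in_tensor: "Poly_Mapping.keys u \<subseteq> carrier M \<times> carrier N \<Longrightarrow> TR #>\<^bsub>FF\<^esub> u \<in> carrier MN"
  by (auto simp: carrier_tensor FactGroup_def RCOSETS_def)

lemma tensor_cosetE:
  assumes "t \<in> carrier MN"
  obtains u where "Poly_Mapping.keys u \<subseteq> carrier M \<times> carrier N" "t = TR #>\<^bsub>FF\<^esub> u"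
  using assms by (auto simp: carrier_tensor FactGroup_def RCOSETS_def)

lemma coset_add:
  assumes "Poly_Mapping.keys u \<subseteq> carrier M \<times> carrier N" "Poly_Mapping.keys v \<subseteq> carrier M \<times> carrier N"
  shows "(TR #>\<^bsub>FF\<^esub> u) \<oplus>\<^bsub>MN\<^esub> (TR #>\<^bsub>FF\<^esub> v) = TR #>\<^bsub>FF\<^esub> (u + v)"
proof -
  have "ring.add MN = set_mult FF"
    by (simp add: tensor_def tensor_group_def Let_def FactGroup_def)
  then show ?thesis
    using normal.rcos_sum[OF normal_relations, of u v] assms by simp
qed

lemma coset_eqI:
  assumes "Poly_Mapping.keys u \<subseteq> carrier M \<times> carrier N" "Poly_Mapping.keys v \<subseteq> carrier M \<times> carrier N"
    and "u - v \<in> TR"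
  shows "TR #>\<^bsub>FF\<^esub> u = TR #>\<^bsub>FF\<^esub> v"
proof -
  have "u \<in> TR #>\<^bsub>FF\<^esub> v"
    using subgroup.rcos_module[OF subgroup_relations, of v u] assms by (simp add: F.is_group)
  then show ?thesis
    using F.repr_independence[OF _ _ subgroup_relations] assms(2) by simp
qed

lemma pure_closed [simp]: "\<lbrakk>x \<in> carrier M; y \<in> carrier N\<rbrakk> \<Longrightarrow> pt x y \<in> carrier MN"
  unfolding pure_tensor_def by (rule coset_in_tensor) (simp add: keys_frag_of)

lemma balanced_pure: "balanced A M N MN pt"
proof -
  have 1: "pt (x \<oplus>\<^bsub>M\<^esub> x') y = pt x y \<oplus>\<^bsub>MN\<^esub> pt x' y"
    if "x \<in> carrier M" "x' \<in> carrier M" "y \<in> carrier N" for x x' y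
  proof -
    have "frag_of (x \<oplus>\<^bsub>M\<^esub> x', y) - (frag_of (x, y) + frag_of (x', y)) \<in> TR"
      unfolding tensor_relations_def diff_diff_add[symmetric]
      by (rule generate.incl) (use that in blast)
    then show ?thesis
      using that keys_add[of "frag_of (x, y)" "frag_of (x', y)"]
      unfolding pure_tensor_def
      by (subst coset_add) (simp_all add: keys_frag_of, intro coset_eqI, auto simp: keys_frag_of)
  qed
  have 2: "pt x (y \<oplus>\<^bsub>N\<^esub> y') = pt x y \<oplus>\<^bsub>MN\<^esub> pt x y'"
    if "x \<in> carrier M" "y' \<in> carrier N" "y \<in> carrier N" for x y' y
  proof -
    have "frag_of (x, y \<oplus>\<^bsub>N\<^esub> y') - (frag_of (x, y) + frag_of (x, y')) \<in> TR"
      unfolding tensor_relations_def diff_diff_add[symmetric]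
      by (rule generate.incl) (use that in blast)
    then show ?thesis
      using that keys_add[of "frag_of (x, y)" "frag_of (x, y')"]
      unfolding pure_tensor_def
      by (subst coset_add) (simp_all add: keys_frag_of, intro coset_eqI, auto simp: keys_frag_of)
  qed
  have 3: "pt (x \<triangleleft>\<^bsub>M\<^esub> a) y = pt x (a \<odot>\<^bsub>N\<^esub> y)"
    if "x \<in> carrier M" "a \<in> carrier A" "y \<in> carrier N" for x a y
  proof -
    have "frag_of (x \<triangleleft>\<^bsub>M\<^esub> a, y) - frag_of (x, a \<odot>\<^bsub>N\<^esub> y) \<in> TR"
      unfolding tensor_relations_def by (rule generate.incl) (use that in blast)
    then show ?thesis
      using that unfolding pure_tensor_def
      by (intro coset_eqI) (auto simp: keys_frag_of M.rsmult_closed)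
  qed
  show ?thesis
    unfolding balanced_def using 1 2 3 by auto
qed

lemmas pure_add_left = balanced_pure[unfolded balanced_def, THEN conjunct2, THEN conjunct1, rule_format]
lemmas pure_add_right = balanced_pure[unfolded balanced_def, THEN conjunct2, THEN conjunct2, THEN conjunct1, rule_format]
lemmas pure_balanced = balanced_pure[unfolded balanced_def, THEN conjunct2, THEN conjunct2, THEN conjunct2, rule_format]

lemma pure_zero_left:
  assumes "y \<in> carrier N" shows "pt \<zero>\<^bsub>M\<^esub> y = \<zero>\<^bsub>MN\<^esub>"
proof -
  have "pt \<zero>\<^bsub>M\<^esub> y \<oplus>\<^bsub>MN\<^esub> pt \<zero>\<^bsub>M\<^esub> y = pt \<zero>\<^bsub>M\<^esub> y"
    using pure_add_left[of "\<zero>\<^bsub>M\<^esub>" "\<zero>\<^bsub>M\<^esub>" y] assms by simp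
  then show ?thesis
    using assms T.add.r_cancel_one' by (metis M.M.zero_closed pure_closed)
qed

lemma pure_minus_left:
  assumes "x \<in> carrier M" "y \<in> carrier N" shows "pt (\<ominus>\<^bsub>M\<^esub> x) y = \<ominus>\<^bsub>MN\<^esub> pt x y"
  using pure_add_left[of "\<ominus>\<^bsub>M\<^esub> x" x y] assms
  by (simp add: M.M.l_neg pure_zero_left T.minus_equality)

lemma zero_coset: "\<zero>\<^bsub>MN\<^esub> = TR #>\<^bsub>FF\<^esub> 0"
proof -
  have "\<zero>\<^bsub>MN\<^esub> = TR" by (simp add: tensor_def tensor_group_def Let_def FactGroup_def)
  then show ?thesis
    using F.coset_mult_one[OF subgroup.subset[OF subgroup_relations]] by simp
qed

text \<open>Subtraction is absent from the induction principle because \<open>- (x \<otimes> y) = (- x) \<otimes> y\<close> and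
  \<open>0 = 0 \<otimes> 0\<close>: sums of pure tensors already exhaust the tensor product.\<close>

lemma tensor_induct [consumes 1, case_names pure add]:
  assumes t: "t \<in> carrier MN"
    and pure: "\<And>x y. \<lbrakk>x \<in> carrier M; y \<in> carrier N\<rbrakk> \<Longrightarrow> P (pt x y)"
    and add: "\<And>s t. \<lbrakk>s \<in> carrier MN; t \<in> carrier MN; P s; P t\<rbrakk> \<Longrightarrow> P (s \<oplus>\<^bsub>MN\<^esub> t)"
  shows "P t"
proof -
  obtain u where u: "Poly_Mapping.keys u \<subseteq> carrier M \<times> carrier N" "t = TR #>\<^bsub>FF\<^esub> u"
    using t by (rule tensor_cosetE)
  \<comment> \<open>The negative is carried along so that the difference step of the induction on the free group
    becomes a sum.\<close>
  have "P (TR #>\<^bsub>FF\<^esub> u) \<and> P (TR #>\<^bsub>FF\<^esub> (- u))"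
    using u(1)
  proof (induction u rule: free_Abelian_group_induct[consumes 1, case_names zero diff gen])
    case zero
    have "P \<zero>\<^bsub>MN\<^esub>"
      using pure[of "\<zero>\<^bsub>M\<^esub>" "\<zero>\<^bsub>N\<^esub>"] by (simp add: pure_zero_left)
    then show ?case by (simp add: zero_coset)
  next
    case (diff u v)
    have *: "P (TR #>\<^bsub>FF\<^esub> (u + v))"
      if "P (TR #>\<^bsub>FF\<^esub> u)" "P (TR #>\<^bsub>FF\<^esub> v)"
        "Poly_Mapping.keys u \<subseteq> carrier M \<times> carrier N" "Poly_Mapping.keys v \<subseteq> carrier M \<times> carrier N" for u v
      using add[OF coset_in_tensor coset_in_tensor] that by (simp add: coset_add)
    show ?case
      using *[of u "- v"] *[of "- u" v] diff by (simp add: algebra_simps)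
  next
    case (gen p)
    obtain x y where p: "p = (x, y)" "x \<in> carrier M" "y \<in> carrier N"
      using gen by auto
    have "pt x y \<oplus>\<^bsub>MN\<^esub> (TR #>\<^bsub>FF\<^esub> (- frag_of p)) = \<zero>\<^bsub>MN\<^esub>"
      unfolding pure_tensor_def zero_coset using p by (subst coset_add) (auto simp: keys_frag_of)
    then have "TR #>\<^bsub>FF\<^esub> (- frag_of p) = pt (\<ominus>\<^bsub>M\<^esub> x) y"
      using p coset_in_tensor[of "- frag_of p"]
      by (metis T.add.m_comm T.minus_equality keys_frag_of keys_minus gen SigmaI pure_closed
          pure_minus_left empty_subsetI insert_subset)
    then show ?case
      using pure[of x y] pure[of "\<ominus>\<^bsub>M\<^esub> x" y] p by (simp add: pure_tensor_def)
  qed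
  then show ?thesis using u by simp
qed

context
  fixes G :: "('g, 'q) ring_scheme" and \<phi> :: "'b \<Rightarrow> 'c \<Rightarrow> 'g"
  assumes G: "abelian_group G" and \<phi>: "balanced A M N G \<phi>"
begin

interpretation G: abelian_group G by (rule G)

text \<open>The homomorphism of the free group that extends \<open>\<phi>\<close> kills the defining relations because
  \<open>\<phi>\<close> is balanced. Its value is therefore the same on every representative of a coset, in particular
  on the one chosen in the definition of the induced map.\<close>

lemma tensor_lift_hom:
  obtains h where "h \<in> hom FF (add_monoid G)"
    and "\<And>x y. \<lbrakk>x \<in> carrier M; y \<in> carrier N\<rbrakk> \<Longrightarrow> h (frag_of (x, y)) = \<phi> x y"
    and "\<And>u. Poly_Mapping.keys u \<subseteq> carrier M \<times> carrier N \<Longrightarrow> tensor_lift G \<phi> (TR #>\<^bsub>FF\<^esub> u) = h u"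
proof -
  have "(\<lambda>(x, y). \<phi> x y) ` (carrier M \<times> carrier N) \<subseteq> carrier (add_monoid G)"
    using \<phi> by (auto simp: balanced_def)
  then obtain h where h: "h \<in> hom FF (add_monoid G)"
    and h_of: "\<And>p. p \<in> carrier M \<times> carrier N \<Longrightarrow> h (frag_of p) = (\<lambda>(x, y). \<phi> x y) p"
    using comm_group.free_Abelian_group_universal[OF G.a_comm_group] by metis
  interpret h: group_hom FF "add_monoid G" h
    using h G.a_group by (simp add: group_hom_def group_hom_axioms_def)
  have hdiff: "h (u - v) = h u \<ominus>\<^bsub>G\<^esub> h v"
    if "Poly_Mapping.keys u \<subseteq> carrier M \<times> carrier N" "Poly_Mapping.keys v \<subseteq> carrier M \<times> carrier N" for u v
    using h.hom_mult[of u "- v"] h.hom_inv[of v] that by (simp add: a_minus_def a_inv_def)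
  have hcl: "h u \<in> carrier G" if "Poly_Mapping.keys u \<subseteq> carrier M \<times> carrier N" for u
    using h.hom_closed that by simp
  have z: "\<lbrakk>a = b; b \<in> carrier G\<rbrakk> \<Longrightarrow> a \<ominus>\<^bsub>G\<^esub> b = \<zero>\<^bsub>G\<^esub>" for a b
    by (simp add: a_minus_def G.r_neg)
  have mm: "\<lbrakk>a = b \<oplus>\<^bsub>G\<^esub> c; b \<in> carrier G; c \<in> carrier G\<rbrakk> \<Longrightarrow> a \<ominus>\<^bsub>G\<^esub> b \<ominus>\<^bsub>G\<^esub> c = \<zero>\<^bsub>G\<^esub>" for a b c
    by (simp add: a_minus_def G.r_neg G.minus_add G.a_assoc G.r_neg1 G.r_neg2 G.a_comm[of b c])
  have ker: "subgroup (kernel FF (add_monoid G) h) FF"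
    by (rule h.subgroup_kernel)
  have kd: "Poly_Mapping.keys (u - v) \<subseteq> carrier M \<times> carrier N"
    if "Poly_Mapping.keys u \<subseteq> carrier M \<times> carrier N" "Poly_Mapping.keys v \<subseteq> carrier M \<times> carrier N" for u v :: "_ \<Rightarrow>\<^sub>0 int"
    using that keys_diff[of u v] by auto
  have TR: "TR \<subseteq> kernel FF (add_monoid G) h"
    unfolding tensor_relations_def
  proof (rule F.generate_subgroup_incl[OF _ ker], safe)
    fix x x' y assume "x \<in> carrier M" "x' \<in> carrier M" "y \<in> carrier N"
    then show "frag_of (x \<oplus>\<^bsub>M\<^esub> x', y) - frag_of (x, y) - frag_of (x', y) \<in> kernel FF (add_monoid G) h"
      using \<phi> by (simp add: kernel_def kd hdiff keys_frag_of h_of mm balanced_def)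
  next
    fix x y y' assume "x \<in> carrier M" "y \<in> carrier N" "y' \<in> carrier N"
    then show "frag_of (x, y \<oplus>\<^bsub>N\<^esub> y') - frag_of (x, y) - frag_of (x, y') \<in> kernel FF (add_monoid G) h"
      using \<phi> by (simp add: kernel_def kd hdiff keys_frag_of h_of mm balanced_def)
  next
    fix x a y assume "x \<in> carrier M" "a \<in> carrier A" "y \<in> carrier N"
    then show "frag_of (x \<triangleleft>\<^bsub>M\<^esub> a, y) - frag_of (x, a \<odot>\<^bsub>N\<^esub> y) \<in> kernel FF (add_monoid G) h"
      using \<phi> by (simp add: kernel_def kd hdiff keys_frag_of h_of z balanced_def M.rsmult_closed)
  qed
  show thesis
  proof
    show "h \<in> hom FF (add_monoid G)" by fact
    show "\<And>x y. \<lbrakk>x \<in> carrier M; y \<in> carrier N\<rbrakk> \<Longrightarrow> h (frag_of (x, y)) = \<phi> x y"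
      using h_of by simp
    fix u :: "'b \<times> 'c \<Rightarrow>\<^sub>0 int" assume u: "Poly_Mapping.keys u \<subseteq> carrier M \<times> carrier N"
    define v where "v = (SOME v. v \<in> TR #>\<^bsub>FF\<^esub> u)"
    have "u \<in> TR #>\<^bsub>FF\<^esub> u"
      using F.rcos_self[OF _ subgroup_relations] u by simp
    then have "v \<in> TR #>\<^bsub>FF\<^esub> u"
      unfolding v_def by (rule someI)
    then obtain r where r: "r \<in> TR" "v = r + u"
      by (auto simp: r_coset_def)
    have kr: "Poly_Mapping.keys r \<subseteq> carrier M \<times> carrier N" "h r = \<zero>\<^bsub>G\<^esub>"
      using r TR by (auto simp: kernel_def)
    have kv: "Poly_Mapping.keys v \<subseteq> carrier M \<times> carrier N"
      using kr u r keys_add[of r u] by auto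
    have "h v = h u"
      using h.hom_mult[of r u] kr u r hcl[OF u] by simp
    moreover have "tensor_lift G \<phi> (TR #>\<^bsub>FF\<^esub> u) =
        (\<Oplus>\<^bsub>G\<^esub>p \<in> Poly_Mapping.keys v. [Poly_Mapping.lookup v p] \<cdot>\<^bsub>G\<^esub> \<phi> (fst p) (snd p))"
      by (simp add: tensor_lift_def v_def Let_def)
    moreover have "\<dots> = (\<Oplus>\<^bsub>G\<^esub>p \<in> Poly_Mapping.keys v. [Poly_Mapping.lookup v p] \<cdot>\<^bsub>G\<^esub> h (frag_of p))"
    proof (rule G.finsum_cong')
      fix p assume "p \<in> Poly_Mapping.keys v"
      then have "p \<in> carrier M \<times> carrier N" using kv by blast
      then show "[Poly_Mapping.lookup v p] \<cdot>\<^bsub>G\<^esub> \<phi> (fst p) (snd p) = [Poly_Mapping.lookup v p] \<cdot>\<^bsub>G\<^esub> h (frag_of p)"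
        by (simp add: h_of split_beta)
    next
      show "(\<lambda>p. [Poly_Mapping.lookup v p] \<cdot>\<^bsub>G\<^esub> h (frag_of p)) \<in> Poly_Mapping.keys v \<rightarrow> carrier G"
        using kv hcl by (auto simp: keys_frag_of subset_iff intro!: G.add.int_pow_closed)
    qed simp
    ultimately show "tensor_lift G \<phi> (TR #>\<^bsub>FF\<^esub> u) = h u"
      using hom_free_Abelian_group_expansion[OF G h kv] by simp
  qed
qed

lemma tensor_lift_closed: "t \<in> carrier MN \<Longrightarrow> tensor_lift G \<phi> t \<in> carrier G"
proof -
  obtain h where h: "h \<in> hom FF (add_monoid G)"
    and l: "\<And>u. Poly_Mapping.keys u \<subseteq> carrier M \<times> carrier N \<Longrightarrow> tensor_lift G \<phi> (TR #>\<^bsub>FF\<^esub> u) = h u"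
    using tensor_lift_hom by metis
  assume "t \<in> carrier MN"
  then show ?thesis
    using hom_carrier[OF h] by (auto elim!: tensor_cosetE simp: l image_subset_iff)
qed

lemma tensor_lift_pure:
  assumes "x \<in> carrier M" "y \<in> carrier N"
  shows "tensor_lift G \<phi> (pt x y) = \<phi> x y"
  by (rule tensor_lift_hom) (use assms in \<open>simp add: pure_tensor_def keys_frag_of\<close>)

lemma tensor_lift_add:
  assumes "s \<in> carrier MN" "t \<in> carrier MN"
  shows "tensor_lift G \<phi> (s \<oplus>\<^bsub>MN\<^esub> t) = tensor_lift G \<phi> s \<oplus>\<^bsub>G\<^esub> tensor_lift G \<phi> t"
proof -
  obtain h where h: "h \<in> hom FF (add_monoid G)"
    and l: "\<And>u. Poly_Mapping.keys u \<subseteq> carrier M \<times> carrier N \<Longrightarrow> tensor_lift G \<phi> (TR #>\<^bsub>FF\<^esub> u) = h u"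
    using tensor_lift_hom by metis
  obtain u v where uv: "Poly_Mapping.keys u \<subseteq> carrier M \<times> carrier N" "Poly_Mapping.keys v \<subseteq> carrier M \<times> carrier N"
    "s = TR #>\<^bsub>FF\<^esub> u" "t = TR #>\<^bsub>FF\<^esub> v"
    using assms by (auto elim!: tensor_cosetE)
  moreover have "Poly_Mapping.keys (u + v) \<subseteq> carrier M \<times> carrier N"
    using uv keys_add[of u v] by auto
  ultimately show ?thesis
    using hom_mult[OF h, of u v] by (simp add: coset_add l)
qed

end

lemma balanced_cong:
  assumes "balanced A M N G \<phi>"
    and "\<And>x y. \<lbrakk>x \<in> carrier M; y \<in> carrier N\<rbrakk> \<Longrightarrow> \<psi> x y = \<phi> x y"
  shows "balanced A M N G \<psi>"
  using assms by (simp add: balanced_def M.rsmult_closed N.smult_closed)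

text \<open>Tensors are cosets in the free group on the carriers, so only the values of a balanced map on
  the carriers matter; it may be arbitrary elsewhere.\<close>

lemma tensor_lift_cong:
  assumes G: "abelian_group G" and \<phi>: "balanced A M N G \<phi>"
    and eq: "\<And>x y. \<lbrakk>x \<in> carrier M; y \<in> carrier N\<rbrakk> \<Longrightarrow> \<psi> x y = \<phi> x y"
    and t: "t \<in> carrier MN"
  shows "tensor_lift G \<psi> t = tensor_lift G \<phi> t"
proof -
  note \<psi> = balanced_cong[OF \<phi> eq]
  show ?thesis
    using t by (induction t rule: tensor_induct)
      (simp_all add: tensor_lift_pure[OF G] tensor_lift_add[OF G] \<phi> \<psi> eq)
qed

lemma additive_tensor_lift:
  assumes G: "abelian_group G" and \<phi>: "balanced A M N G \<phi>" and H: "abelian_group H"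
    and h_closed: "\<And>x. x \<in> carrier G \<Longrightarrow> h x \<in> carrier H"
    and h_add: "\<And>x y. \<lbrakk>x \<in> carrier G; y \<in> carrier G\<rbrakk> \<Longrightarrow> h (x \<oplus>\<^bsub>G\<^esub> y) = h x \<oplus>\<^bsub>H\<^esub> h y"
    and t: "t \<in> carrier MN"
  shows "h (tensor_lift G \<phi> t) = tensor_lift H (\<lambda>x y. h (\<phi> x y)) t"
proof -
  have \<psi>: "balanced A M N H (\<lambda>x y. h (\<phi> x y))"
    using \<phi> by (auto simp: balanced_def h_closed h_add)
  show ?thesis
    using t by (induction t rule: tensor_induct)
      (simp_all add: tensor_lift_pure[OF G \<phi>] tensor_lift_add[OF G \<phi>] tensor_lift_closed[OF G \<phi>]
        tensor_lift_pure[OF H \<psi>] tensor_lift_add[OF H \<psi>] h_add)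
qed

text \<open>The actions on a tensor product are induced maps whose target is the underlying group without
  actions, so that group, and not the bimodule, is the codomain here.\<close>

lemma balanced_smult: "a \<in> carrier A \<Longrightarrow> balanced A M N (tensor_group A M N) (\<lambda>x y. pt (a \<odot>\<^bsub>M\<^esub> x) y)"
  by (simp add: balanced_def tensor_group_simps M.smult_closed M.smult_r_distr N.smult_closed
      pure_add_left pure_add_right M.smult_rsmult[symmetric] pure_balanced)

lemma balanced_rsmult: "a \<in> carrier A \<Longrightarrow> balanced A M N (tensor_group A M N) (\<lambda>x y. pt x (y \<triangleleft>\<^bsub>N\<^esub> a))"
  by (simp add: balanced_def tensor_group_simps N.rsmult_closed N.rsmult_l_distr M.rsmult_closed
      pure_add_left pure_add_right N.smult_rsmult pure_balanced)

lemma smult_tensor: "a \<odot>\<^bsub>MN\<^esub> t = tensor_lift (tensor_group A M N) (\<lambda>x y. pt (a \<odot>\<^bsub>M\<^esub> x) y) t"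
  by (simp add: tensor_def Let_def)

lemma rsmult_tensor: "t \<triangleleft>\<^bsub>MN\<^esub> a = tensor_lift (tensor_group A M N) (\<lambda>x y. pt x (y \<triangleleft>\<^bsub>N\<^esub> a)) t"
  by (simp add: tensor_def Let_def)

lemma smult_pure:
  "\<lbrakk>a \<in> carrier A; x \<in> carrier M; y \<in> carrier N\<rbrakk> \<Longrightarrow> a \<odot>\<^bsub>MN\<^esub> pt x y = pt (a \<odot>\<^bsub>M\<^esub> x) y"
  by (simp add: smult_tensor tensor_lift_pure[OF abelian_group_tensor_group balanced_smult])

lemma rsmult_pure:
  "\<lbrakk>a \<in> carrier A; x \<in> carrier M; y \<in> carrier N\<rbrakk> \<Longrightarrow> pt x y \<triangleleft>\<^bsub>MN\<^esub> a = pt x (y \<triangleleft>\<^bsub>N\<^esub> a)"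
  by (simp add: rsmult_tensor tensor_lift_pure[OF abelian_group_tensor_group balanced_rsmult])

lemma smult_tensor_add:
  "\<lbrakk>a \<in> carrier A; s \<in> carrier MN; t \<in> carrier MN\<rbrakk>
    \<Longrightarrow> a \<odot>\<^bsub>MN\<^esub> (s \<oplus>\<^bsub>MN\<^esub> t) = a \<odot>\<^bsub>MN\<^esub> s \<oplus>\<^bsub>MN\<^esub> a \<odot>\<^bsub>MN\<^esub> t"
  by (simp add: smult_tensor tensor_lift_add[OF abelian_group_tensor_group balanced_smult] tensor_group_simps)

lemma rsmult_tensor_add:
  "\<lbrakk>a \<in> carrier A; s \<in> carrier MN; t \<in> carrier MN\<rbrakk>
    \<Longrightarrow> (s \<oplus>\<^bsub>MN\<^esub> t) \<triangleleft>\<^bsub>MN\<^esub> a = s \<triangleleft>\<^bsub>MN\<^esub> a \<oplus>\<^bsub>MN\<^esub> t \<triangleleft>\<^bsub>MN\<^esub> a"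
  by (simp add: rsmult_tensor tensor_lift_add[OF abelian_group_tensor_group balanced_rsmult] tensor_group_simps)

lemma smult_tensor_closed: "\<lbrakk>a \<in> carrier A; t \<in> carrier MN\<rbrakk> \<Longrightarrow> a \<odot>\<^bsub>MN\<^esub> t \<in> carrier MN"
  using tensor_lift_closed[OF abelian_group_tensor_group balanced_smult]
  by (simp add: smult_tensor tensor_group_simps)

lemma rsmult_tensor_closed: "\<lbrakk>a \<in> carrier A; t \<in> carrier MN\<rbrakk> \<Longrightarrow> t \<triangleleft>\<^bsub>MN\<^esub> a \<in> carrier MN"
  using tensor_lift_closed[OF abelian_group_tensor_group balanced_rsmult]
  by (simp add: rsmult_tensor tensor_group_simps)

lemma bimodule_tensor: "bimodule K A MN"
proof -
  note clo = smult_tensor_closed rsmult_tensor_closed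
  note cl = clo M.smult_closed N.smult_closed M.rsmult_closed N.rsmult_closed
  note ad = smult_tensor_add rsmult_tensor_add
  note pu = smult_pure rsmult_pure
  have l_distr: "(a \<oplus>\<^bsub>A\<^esub> b) \<odot>\<^bsub>MN\<^esub> t = a \<odot>\<^bsub>MN\<^esub> t \<oplus>\<^bsub>MN\<^esub> b \<odot>\<^bsub>MN\<^esub> t"
    if "a \<in> carrier A" "b \<in> carrier A" "t \<in> carrier MN" for a b t
    using that(3) by (induction t rule: tensor_induct)
      (use that(1,2) in \<open>simp_all add: cl ad pu M.smult_l_distr pure_add_left T.a_ac\<close>)
  have assoc: "(a \<otimes>\<^bsub>A\<^esub> b) \<odot>\<^bsub>MN\<^esub> t = a \<odot>\<^bsub>MN\<^esub> (b \<odot>\<^bsub>MN\<^esub> t)"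
    if "a \<in> carrier A" "b \<in> carrier A" "t \<in> carrier MN" for a b t
    using that(3) by (induction t rule: tensor_induct)
      (use that(1,2) in \<open>simp_all add: cl ad pu M.smult_assoc1\<close>)
  have one: "\<one>\<^bsub>A\<^esub> \<odot>\<^bsub>MN\<^esub> t = t" if "t \<in> carrier MN" for t
    using that by (induction t rule: tensor_induct) (simp_all add: ad pu)
  have r_distr: "t \<triangleleft>\<^bsub>MN\<^esub> (a \<oplus>\<^bsub>A\<^esub> b) = t \<triangleleft>\<^bsub>MN\<^esub> a \<oplus>\<^bsub>MN\<^esub> t \<triangleleft>\<^bsub>MN\<^esub> b"
    if "a \<in> carrier A" "b \<in> carrier A" "t \<in> carrier MN" for a b t
    using that(3) by (induction t rule: tensor_induct)
      (use that(1,2) in \<open>simp_all add: cl ad pu N.rsmult_r_distr pure_add_right T.a_ac\<close>)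
  have rassoc: "t \<triangleleft>\<^bsub>MN\<^esub> (a \<otimes>\<^bsub>A\<^esub> b) = (t \<triangleleft>\<^bsub>MN\<^esub> a) \<triangleleft>\<^bsub>MN\<^esub> b"
    if "a \<in> carrier A" "b \<in> carrier A" "t \<in> carrier MN" for a b t
    using that(3) by (induction t rule: tensor_induct)
      (use that(1,2) in \<open>simp_all add: cl ad pu N.rsmult_assoc\<close>)
  have rone: "t \<triangleleft>\<^bsub>MN\<^esub> \<one>\<^bsub>A\<^esub> = t" if "t \<in> carrier MN" for t
    using that by (induction t rule: tensor_induct) (simp_all add: ad pu N.rsmult_one)
  have bi: "(a \<odot>\<^bsub>MN\<^esub> t) \<triangleleft>\<^bsub>MN\<^esub> b = a \<odot>\<^bsub>MN\<^esub> (t \<triangleleft>\<^bsub>MN\<^esub> b)"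
    if "a \<in> carrier A" "b \<in> carrier A" "t \<in> carrier MN" for a b t
    using that(3) by (induction t rule: tensor_induct)
      (use that(1,2) in \<open>simp_all add: cl ad pu\<close>)
  have cen: "(k \<odot>\<^bsub>A\<^esub> \<one>\<^bsub>A\<^esub>) \<odot>\<^bsub>MN\<^esub> t = t \<triangleleft>\<^bsub>MN\<^esub> (k \<odot>\<^bsub>A\<^esub> \<one>\<^bsub>A\<^esub>)"
    if "k \<in> carrier K" "t \<in> carrier MN" for k t
    using that(2) by (induction t rule: tensor_induct)
      (use that(1) in \<open>simp_all add: ad pu M.central N.central[symmetric] pure_balanced
        M.A.smult_closed\<close>)
  show ?thesis
    by (intro bimodule.intro bimodule_axioms.intro moduleI M.A.algebra_axioms M.A.M_cring
        abelian_group_tensor)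
      (simp_all add: clo ad l_distr assoc one r_distr rassoc rone bi cen)
qed

end

section \<open>Functoriality and associativity of the tensor product\<close>

context
  fixes K :: "('k, 'm) ring_scheme" and A :: "('k, 'a, 'n) module_scheme"
    and M :: "('a, 'b, 'o) bimodule_scheme" and N :: "('a, 'c, 'p) bimodule_scheme"
    and M' :: "('a, 'd, 'q) bimodule_scheme" and N' :: "('a, 'e, 's) bimodule_scheme"
    and f g
  assumes pair: "bimodule_pair K A M N" and pair': "bimodule_pair K A M' N'"
    and f: "f \<in> bimodule_hom A M M'" and g: "g \<in> bimodule_hom A N N'"
begin

interpretation P: bimodule_pair K A M N by (rule pair)
interpretation P': bimodule_pair K A M' N' by (rule pair')

lemma balanced_comp_hom: "balanced A M' N' G \<phi> \<Longrightarrow> balanced A M N G (\<lambda>x y. \<phi> (f x) (g y))"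
  by (simp add: balanced_def bimodule_homD[OF f] bimodule_homD[OF g])

lemmas balanced_tensor_map = balanced_comp_hom[OF P'.balanced_pure]

lemma tensor_map_pure:
  "\<lbrakk>x \<in> carrier M; y \<in> carrier N\<rbrakk>
    \<Longrightarrow> tensor_map A M' N' f g (pure_tensor A M N x y) = pure_tensor A M' N' (f x) (g y)"
  unfolding tensor_map_def
  by (rule P.tensor_lift_pure[OF P'.abelian_group_tensor balanced_tensor_map])

lemma tensor_map_add:
  "\<lbrakk>s \<in> carrier (tensor A M N); t \<in> carrier (tensor A M N)\<rbrakk>
    \<Longrightarrow> tensor_map A M' N' f g (s \<oplus>\<^bsub>tensor A M N\<^esub> t) =
        tensor_map A M' N' f g s \<oplus>\<^bsub>tensor A M' N'\<^esub> tensor_map A M' N' f g t"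
  unfolding tensor_map_def
  by (rule P.tensor_lift_add[OF P'.abelian_group_tensor balanced_tensor_map])

lemma tensor_map_closed:
  "t \<in> carrier (tensor A M N) \<Longrightarrow> tensor_map A M' N' f g t \<in> carrier (tensor A M' N')"
  unfolding tensor_map_def
  by (rule P.tensor_lift_closed[OF P'.abelian_group_tensor balanced_tensor_map])

lemma tensor_map_hom:
  "tensor_map A M' N' f g \<in> bimodule_hom A (tensor A M N) (tensor A M' N')"
proof (rule bimodule_homI)
  fix a t assume a: "a \<in> carrier A" and t: "t \<in> carrier (tensor A M N)"
  note simps = P.smult_pure P.rsmult_pure P'.smult_pure P'.rsmult_pure tensor_map_pure
    tensor_map_add tensor_map_closed P.M.smult_closed P.N.rsmult_closed bimodule_homD[OF f] bimodule_homD[OF g]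
    P.smult_tensor_closed P.rsmult_tensor_closed P.smult_tensor_add P'.smult_tensor_add P.rsmult_tensor_add P'.rsmult_tensor_add
  show "tensor_map A M' N' f g (a \<odot>\<^bsub>tensor A M N\<^esub> t) = a \<odot>\<^bsub>tensor A M' N'\<^esub> tensor_map A M' N' f g t"
    using t by (induction t rule: P.tensor_induct) (use a in \<open>simp_all add: simps\<close>)
  show "tensor_map A M' N' f g (t \<triangleleft>\<^bsub>tensor A M N\<^esub> a) = tensor_map A M' N' f g t \<triangleleft>\<^bsub>tensor A M' N'\<^esub> a"
    using t by (induction t rule: P.tensor_induct) (use a in \<open>simp_all add: simps\<close>)
qed (simp_all add: tensor_map_add tensor_map_closed)

lemma tensor_lift_tensor_map:
  assumes G: "abelian_group G" and \<phi>: "balanced A M' N' G \<phi>" and t: "t \<in> carrier (tensor A M N)"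
  shows "tensor_lift G \<phi> (tensor_map A M' N' f g t) = tensor_lift G (\<lambda>x y. \<phi> (f x) (g y)) t"
proof -
  note \<psi> = balanced_comp_hom[OF \<phi>]
  show ?thesis
    using t by (induction t rule: P.tensor_induct)
      (simp_all add: tensor_map_pure tensor_map_add tensor_map_closed bimodule_homD[OF f] bimodule_homD[OF g]
        P.tensor_lift_pure[OF G \<psi>] P.tensor_lift_add[OF G \<psi>]
        P'.tensor_lift_pure[OF G \<phi>] P'.tensor_lift_add[OF G \<phi>])
qed

lemma tensor_map_cong:
  assumes "\<And>x. x \<in> carrier M \<Longrightarrow> f' x = f x" "\<And>y. y \<in> carrier N \<Longrightarrow> g' y = g y"
    and t: "t \<in> carrier (tensor A M N)"
  shows "tensor_map A M' N' f' g' t = tensor_map A M' N' f g t"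
  unfolding tensor_map_def
  by (rule P.tensor_lift_cong[OF P'.abelian_group_tensor balanced_tensor_map _ t]) (simp add: assms)

end

lemma tensor_map_compose:
  assumes "bimodule_pair K A M N" "bimodule_pair K A M' N'" "bimodule_pair K A M'' N''"
    and "f \<in> bimodule_hom A M M'" "g \<in> bimodule_hom A N N'"
    and "f' \<in> bimodule_hom A M' M''" "g' \<in> bimodule_hom A N' N''"
    and "t \<in> carrier (tensor A M N)"
  shows "tensor_map A M'' N'' f' g' (tensor_map A M' N' f g t) =
    tensor_map A M'' N'' (\<lambda>x. f' (f x)) (\<lambda>y. g' (g y)) t"
  unfolding tensor_map_def[of A M'' N'']
  by (rule tensor_lift_tensor_map[OF assms(1,2,4,5) bimodule_pair.abelian_group_tensor[OF assms(3)]
      balanced_tensor_map[OF assms(2,3,6,7)] assms(8)])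

lemma tensor_map_id:
  assumes "bimodule_pair K A M N" and t: "t \<in> carrier (tensor A M N)"
  shows "tensor_map A M N (\<lambda>x. x) (\<lambda>y. y) t = t"
proof -
  interpret bimodule_pair K A M N by fact
  show ?thesis
    using t by (induction t rule: tensor_induct)
      (simp_all add: tensor_map_pure[OF assms(1,1) bimodule_hom_id bimodule_hom_id]
        tensor_map_add[OF assms(1,1) bimodule_hom_id bimodule_hom_id])
qed

locale bimodule_triple = M: bimodule K A M + N: bimodule K A N + P: bimodule K A P
  for K :: "('k, 'm) ring_scheme" and A :: "('k, 'a, 'n) module_scheme"
    and M :: "('a, 'b, 'o) bimodule_scheme" and N :: "('a, 'c, 'p) bimodule_scheme"
    and P :: "('a, 'd, 'q) bimodule_scheme"
begin

sublocale MN: bimodule_pair K A M N ..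
sublocale NP: bimodule_pair K A N P ..
sublocale MN_P: bimodule_pair K A "tensor A M N" P
  using MN.bimodule_tensor P.bimodule_axioms by (rule bimodule_pair.intro)
sublocale M_NP: bimodule_pair K A M "tensor A N P"
  using M.bimodule_axioms NP.bimodule_tensor by (rule bimodule_pair.intro)

abbreviation "T3 \<equiv> tensor A M (tensor A N P)"

lemma balanced_assoc_inner:
  "z \<in> carrier P \<Longrightarrow>
    balanced A M N T3 (\<lambda>x y. pure_tensor A M (tensor A N P) x (pure_tensor A N P y z))"
  by (simp add: balanced_def M_NP.pure_add_left M_NP.pure_add_right NP.pure_add_left
      M_NP.pure_balanced NP.smult_pure)

text \<open>The associator is induced twice: for fixed \<open>z\<close> the inner map \<open>x \<otimes> y \<mapsto> x \<otimes> (y \<otimes> z)\<close> is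
  induced from \<open>M \<times> N\<close>, and then the family of these maps must be balanced in \<open>(t, z)\<close>. Additivity in
  \<open>t\<close> holds for any induced map; the conditions that involve \<open>z\<close> are checked on pure tensors \<open>t\<close>.\<close>

lemma balanced_assoc:
  "balanced A (tensor A M N) P T3 (\<lambda>t z. tensor_lift T3 (\<lambda>x y.
     pure_tensor A M (tensor A N P) x (pure_tensor A N P y z)) t)"
    (is "balanced _ _ _ _ (\<lambda>t z. ?\<alpha> t z)")
proof -
  note G = M_NP.abelian_group_tensor
  note pure = MN.tensor_lift_pure[OF G balanced_assoc_inner]
  note add = MN.tensor_lift_add[OF G balanced_assoc_inner]
  note closed = MN.tensor_lift_closed[OF G balanced_assoc_inner]
  have right: "?\<alpha> t (z \<oplus>\<^bsub>P\<^esub> z') = ?\<alpha> t z \<oplus>\<^bsub>T3\<^esub> ?\<alpha> t z'"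
    if "t \<in> carrier (tensor A M N)" "z \<in> carrier P" "z' \<in> carrier P" for t z z'
    using that(1) by (induction t rule: MN.tensor_induct)
      (use that(2,3) in \<open>simp_all add: pure add closed NP.pure_add_right M_NP.pure_add_right M_NP.T.a_ac\<close>)
  have bal: "?\<alpha> (t \<triangleleft>\<^bsub>tensor A M N\<^esub> a) z = ?\<alpha> t (a \<odot>\<^bsub>P\<^esub> z)"
    if "t \<in> carrier (tensor A M N)" "z \<in> carrier P" "a \<in> carrier A" for t z a
    using that(1) by (induction t rule: MN.tensor_induct)
      (use that(2,3) in \<open>simp_all add: pure add closed MN.rsmult_pure MN.rsmult_tensor_add
        MN.rsmult_tensor_closed N.rsmult_closed P.smult_closed NP.pure_balanced\<close>)
  show ?thesis
    by (simp add: balanced_def closed add right bal)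
qed

lemma tensor_assoc_pure:
  assumes "x \<in> carrier M" "y \<in> carrier N" "z \<in> carrier P"
  shows "tensor_assoc A M N P (pure_tensor A (tensor A M N) P (pure_tensor A M N x y) z) =
    pure_tensor A M (tensor A N P) x (pure_tensor A N P y z)"
  using assms
  by (simp add: tensor_assoc_def Let_def MN_P.tensor_lift_pure[OF M_NP.abelian_group_tensor balanced_assoc]
      MN.tensor_lift_pure[OF M_NP.abelian_group_tensor balanced_assoc_inner])

lemma tensor_assoc_add:
  assumes "s \<in> carrier (tensor A (tensor A M N) P)" "t \<in> carrier (tensor A (tensor A M N) P)"
  shows "tensor_assoc A M N P (s \<oplus>\<^bsub>tensor A (tensor A M N) P\<^esub> t) =
    tensor_assoc A M N P s \<oplus>\<^bsub>T3\<^esub> tensor_assoc A M N P t"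
  using assms
  by (simp add: tensor_assoc_def Let_def MN_P.tensor_lift_add[OF M_NP.abelian_group_tensor balanced_assoc])

lemma tensor_assoc_closed:
  "t \<in> carrier (tensor A (tensor A M N) P) \<Longrightarrow> tensor_assoc A M N P t \<in> carrier T3"
  by (simp add: tensor_assoc_def Let_def MN_P.tensor_lift_closed[OF M_NP.abelian_group_tensor balanced_assoc])

lemma triple_induct [consumes 1, case_names pure add]:
  assumes t: "t \<in> carrier (tensor A (tensor A M N) P)"
    and pure: "\<And>x y z. \<lbrakk>x \<in> carrier M; y \<in> carrier N; z \<in> carrier P\<rbrakk>
      \<Longrightarrow> Q (pure_tensor A (tensor A M N) P (pure_tensor A M N x y) z)"
    and add: "\<And>s t. \<lbrakk>s \<in> carrier (tensor A (tensor A M N) P); t \<in> carrier (tensor A (tensor A M N) P);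
      Q s; Q t\<rbrakk> \<Longrightarrow> Q (s \<oplus>\<^bsub>tensor A (tensor A M N) P\<^esub> t)"
  shows "Q t"
  using t
proof (induction t rule: MN_P.tensor_induct)
  case (pure u z)
  then show ?case
    by (induction u rule: MN.tensor_induct) (simp_all add: MN_P.pure_add_left assms(2,3))
qed (rule add)

end

lemma tensor_assoc_natural:
  assumes "bimodule_triple K A M N P" "bimodule_triple K A M' N' P'"
    and f: "f \<in> bimodule_hom A M M'" and g: "g \<in> bimodule_hom A N N'" and h: "h \<in> bimodule_hom A P P'"
    and t: "t \<in> carrier (tensor A (tensor A M N) P)"
  shows "tensor_assoc A M' N' P' (tensor_map A (tensor A M' N') P' (tensor_map A M' N' f g) h t) =
    tensor_map A M' (tensor A N' P') f (tensor_map A N' P' g h) (tensor_assoc A M N P t)"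
proof -
  interpret X: bimodule_triple K A M N P by fact
  interpret X': bimodule_triple K A M' N' P' by fact
  note fg = tensor_map_hom[OF X.MN.bimodule_pair_axioms X'.MN.bimodule_pair_axioms f g]
  note gh = tensor_map_hom[OF X.NP.bimodule_pair_axioms X'.NP.bimodule_pair_axioms g h]
  note 1 = X.MN_P.bimodule_pair_axioms X'.MN_P.bimodule_pair_axioms fg h
  note 2 = X.M_NP.bimodule_pair_axioms X'.M_NP.bimodule_pair_axioms f gh
  show ?thesis
    using t by (induction t rule: X.triple_induct)
      (simp_all add: X.tensor_assoc_pure X'.tensor_assoc_pure X.tensor_assoc_add X'.tensor_assoc_add
        X.tensor_assoc_closed tensor_map_pure[OF 1] tensor_map_pure[OF 2]
        tensor_map_add[OF 1] tensor_map_add[OF 2] tensor_map_closed[OF 1]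
        tensor_map_pure[OF X.MN.bimodule_pair_axioms X'.MN.bimodule_pair_axioms f g]
        tensor_map_pure[OF X.NP.bimodule_pair_axioms X'.NP.bimodule_pair_axioms g h]
        bimodule_homD(1)[OF f] bimodule_homD(1)[OF g] bimodule_homD(1)[OF h])
qed

section \<open>Carrying coring structures along surjections\<close>

text \<open>The bimodule axioms are equations between operations, apart from closure and the existence of
  negatives, and all of these pass to images. Preservation of
  zero is a separate hypothesis, since for a target not yet known to be a group it does not follow
  from additivity.\<close>

lemma bimodule_surjection:
  assumes "bimodule K A M" and s: "s \<in> bimodule_hom A M N"
    and onto: "s ` carrier M = carrier N" and zero: "s \<zero>\<^bsub>M\<^esub> = \<zero>\<^bsub>N\<^esub>"
  shows "bimodule K A N"
proof -
  interpret M: bimodule K A M by fact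
  note hom = bimodule_homD[OF s]
  have all: "(\<forall>x \<in> carrier N. Q x) \<longleftrightarrow> (\<forall>m \<in> carrier M. Q (s m))" for Q
    by (simp add: onto[symmetric])
  note fold_ops = zero[symmetric] hom(2-4)[symmetric] M.rsmult_closed
  have group: "abelian_group N"
  proof (rule abelian_groupI)
    show "\<zero>\<^bsub>N\<^esub> \<in> carrier N"
      using hom(1)[OF M.M.zero_closed] by (simp add: zero)
    have "\<forall>x \<in> carrier N. \<forall>y \<in> carrier N. x \<oplus>\<^bsub>N\<^esub> y \<in> carrier N"
      unfolding all by (simp add: fold_ops hom(1))
    then show "\<And>x y. \<lbrakk>x \<in> carrier N; y \<in> carrier N\<rbrakk> \<Longrightarrow> x \<oplus>\<^bsub>N\<^esub> y \<in> carrier N" by blast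
    have "\<forall>x \<in> carrier N. \<forall>y \<in> carrier N. \<forall>z \<in> carrier N. (x \<oplus>\<^bsub>N\<^esub> y) \<oplus>\<^bsub>N\<^esub> z = x \<oplus>\<^bsub>N\<^esub> (y \<oplus>\<^bsub>N\<^esub> z)"
      unfolding all by (simp add: fold_ops M.M.a_assoc)
    then show "\<And>x y z. \<lbrakk>x \<in> carrier N; y \<in> carrier N; z \<in> carrier N\<rbrakk>
        \<Longrightarrow> (x \<oplus>\<^bsub>N\<^esub> y) \<oplus>\<^bsub>N\<^esub> z = x \<oplus>\<^bsub>N\<^esub> (y \<oplus>\<^bsub>N\<^esub> z)" by blast
    have "\<forall>x \<in> carrier N. \<forall>y \<in> carrier N. x \<oplus>\<^bsub>N\<^esub> y = y \<oplus>\<^bsub>N\<^esub> x"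
      unfolding all by (simp add: fold_ops M.M.a_comm)
    then show "\<And>x y. \<lbrakk>x \<in> carrier N; y \<in> carrier N\<rbrakk> \<Longrightarrow> x \<oplus>\<^bsub>N\<^esub> y = y \<oplus>\<^bsub>N\<^esub> x" by blast
    have "\<forall>x \<in> carrier N. \<zero>\<^bsub>N\<^esub> \<oplus>\<^bsub>N\<^esub> x = x"
      unfolding all by (simp add: fold_ops)
    then show "\<And>x. x \<in> carrier N \<Longrightarrow> \<zero>\<^bsub>N\<^esub> \<oplus>\<^bsub>N\<^esub> x = x" by blast
    have "\<forall>x \<in> carrier N. \<exists>y \<in> carrier N. y \<oplus>\<^bsub>N\<^esub> x = \<zero>\<^bsub>N\<^esub>"
      unfolding all
    proof
      fix m assume m: "m \<in> carrier M"
      then have "s (\<ominus>\<^bsub>M\<^esub> m) \<oplus>\<^bsub>N\<^esub> s m = \<zero>\<^bsub>N\<^esub>"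
        by (simp add: fold_ops M.M.l_neg)
      then show "\<exists>y \<in> carrier N. y \<oplus>\<^bsub>N\<^esub> s m = \<zero>\<^bsub>N\<^esub>"
        using m hom(1) M.M.a_inv_closed by blast
    qed
    then show "\<And>x. x \<in> carrier N \<Longrightarrow> \<exists>y \<in> carrier N. y \<oplus>\<^bsub>N\<^esub> x = \<zero>\<^bsub>N\<^esub>" by blast
  qed
  have "\<forall>a \<in> carrier A. \<forall>b \<in> carrier A. \<forall>x \<in> carrier N. \<forall>y \<in> carrier N.
      a \<odot>\<^bsub>N\<^esub> x \<in> carrier N \<and> x \<triangleleft>\<^bsub>N\<^esub> a \<in> carrier N \<and>
      (a \<oplus>\<^bsub>A\<^esub> b) \<odot>\<^bsub>N\<^esub> x = a \<odot>\<^bsub>N\<^esub> x \<oplus>\<^bsub>N\<^esub> b \<odot>\<^bsub>N\<^esub> x \<and>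
      a \<odot>\<^bsub>N\<^esub> (x \<oplus>\<^bsub>N\<^esub> y) = a \<odot>\<^bsub>N\<^esub> x \<oplus>\<^bsub>N\<^esub> a \<odot>\<^bsub>N\<^esub> y \<and>
      (a \<otimes>\<^bsub>A\<^esub> b) \<odot>\<^bsub>N\<^esub> x = a \<odot>\<^bsub>N\<^esub> (b \<odot>\<^bsub>N\<^esub> x) \<and> \<one>\<^bsub>A\<^esub> \<odot>\<^bsub>N\<^esub> x = x \<and>
      (x \<oplus>\<^bsub>N\<^esub> y) \<triangleleft>\<^bsub>N\<^esub> a = x \<triangleleft>\<^bsub>N\<^esub> a \<oplus>\<^bsub>N\<^esub> y \<triangleleft>\<^bsub>N\<^esub> a \<and>
      x \<triangleleft>\<^bsub>N\<^esub> (a \<oplus>\<^bsub>A\<^esub> b) = x \<triangleleft>\<^bsub>N\<^esub> a \<oplus>\<^bsub>N\<^esub> x \<triangleleft>\<^bsub>N\<^esub> b \<and>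
      x \<triangleleft>\<^bsub>N\<^esub> (a \<otimes>\<^bsub>A\<^esub> b) = x \<triangleleft>\<^bsub>N\<^esub> a \<triangleleft>\<^bsub>N\<^esub> b \<and> x \<triangleleft>\<^bsub>N\<^esub> \<one>\<^bsub>A\<^esub> = x \<and>
      (a \<odot>\<^bsub>N\<^esub> x) \<triangleleft>\<^bsub>N\<^esub> b = a \<odot>\<^bsub>N\<^esub> (x \<triangleleft>\<^bsub>N\<^esub> b)"
    unfolding all
    by (simp add: fold_ops hom(1) M.smult_l_distr M.smult_r_distr M.smult_assoc1
        M.rsmult_l_distr M.rsmult_r_distr M.rsmult_assoc M.rsmult_one M.smult_rsmult)
  moreover have "\<forall>k \<in> carrier K. \<forall>x \<in> carrier N.
      (k \<odot>\<^bsub>A\<^esub> \<one>\<^bsub>A\<^esub>) \<odot>\<^bsub>N\<^esub> x = x \<triangleleft>\<^bsub>N\<^esub> (k \<odot>\<^bsub>A\<^esub> \<one>\<^bsub>A\<^esub>)"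
    unfolding all by (simp add: fold_ops M.central M.A.smult_closed)
  moreover have "\<one>\<^bsub>A\<^esub> \<in> carrier A" by simp
  ultimately show ?thesis
    by (intro bimodule.intro bimodule_axioms.intro moduleI M.A.algebra_axioms M.A.M_cring group) blast+
qed

lemma (in bimodule) bimodule_pairI: "bimodule K A N \<Longrightarrow> bimodule_pair K A M N"
  using bimodule_axioms by (rule bimodule_pair.intro)

context coring
begin

sublocale CC: bimodule_pair K A C C ..
sublocale CCC: bimodule_triple K A C C C ..

lemmas comult = bimodule_homD[OF comult_hom]

lemma counit:
  "x \<in> carrier C \<Longrightarrow> \<epsilon> x \<in> carrier A"
  "\<lbrakk>x \<in> carrier C; y \<in> carrier C\<rbrakk> \<Longrightarrow> \<epsilon> (x \<oplus> y) = \<epsilon> x \<oplus>\<^bsub>A\<^esub> \<epsilon> y"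
  "\<lbrakk>a \<in> carrier A; x \<in> carrier C\<rbrakk> \<Longrightarrow> \<epsilon> (a \<odot> x) = a \<otimes>\<^bsub>A\<^esub> \<epsilon> x"
  "\<lbrakk>a \<in> carrier A; x \<in> carrier C\<rbrakk> \<Longrightarrow> \<epsilon> (x \<triangleleft> a) = \<epsilon> x \<otimes>\<^bsub>A\<^esub> a"
  using bimodule_homD[OF counit_hom] by (simp_all add: regular_bimodule_def)

end

lemma coring_homD:
  assumes "g \<in> coring_hom A C \<Delta> \<epsilon> D \<Delta>' \<epsilon>'"
  shows "g \<in> bimodule_hom A C D"
    and "c \<in> carrier C \<Longrightarrow> \<Delta>' (g c) = tensor_map A D D g g (\<Delta> c)"
    and "c \<in> carrier C \<Longrightarrow> \<epsilon>' (g c) = \<epsilon> c"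
  using assms by (auto simp: coring_hom_def)

lemma coring_hom_compose:
  assumes C: "coring K A C \<Delta> \<epsilon>" and D: "coring K A D \<Delta>' \<epsilon>'" and E: "coring K A E \<Delta>'' \<epsilon>''"
    and g: "g \<in> coring_hom A C \<Delta> \<epsilon> D \<Delta>' \<epsilon>'" and h: "h \<in> coring_hom A D \<Delta>' \<epsilon>' E \<Delta>'' \<epsilon>''"
  shows "(\<lambda>c. h (g c)) \<in> coring_hom A C \<Delta> \<epsilon> E \<Delta>'' \<epsilon>''"
proof -
  interpret C: coring K A C \<Delta> \<epsilon> by fact
  interpret D: coring K A D \<Delta>' \<epsilon>' by fact
  interpret E: coring K A E \<Delta>'' \<epsilon>'' by fact
  note g' = coring_homD[OF g] and h' = coring_homD[OF h]
  show ?thesis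
    unfolding coring_hom_def
    by (simp add: bimodule_hom_compose[OF g'(1) h'(1)] g'(2,3) h'(2,3) bimodule_homD(1)[OF g'(1)]
        C.comult(1) tensor_map_compose[OF C.CC.bimodule_pair_axioms D.CC.bimodule_pair_axioms
          E.CC.bimodule_pair_axioms g'(1) g'(1) h'(1) h'(1)])
qed

lemma coring_hom_id:
  assumes "coring K A C \<Delta> \<epsilon>"
  shows "(\<lambda>c. c) \<in> coring_hom A C \<Delta> \<epsilon> C \<Delta> \<epsilon>"
proof -
  interpret C: coring K A C \<Delta> \<epsilon> by fact
  show ?thesis
    by (simp add: coring_hom_def bimodule_hom_id tensor_map_id[OF C.CC.bimodule_pair_axioms] C.comult(1))
qed

lemma coring_hom_cong:
  assumes C: "coring K A C \<Delta> \<epsilon>" and D: "bimodule K A D"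
    and g: "g \<in> coring_hom A C \<Delta> \<epsilon> D \<Delta>' \<epsilon>'" and eq: "\<And>c. c \<in> carrier C \<Longrightarrow> g' c = g c"
  shows "g' \<in> coring_hom A C \<Delta> \<epsilon> D \<Delta>' \<epsilon>'"
proof -
  interpret C: coring K A C \<Delta> \<epsilon> by fact
  interpret D: bimodule K A D by fact
  note g' = coring_homD[OF g]
  have "g' \<in> bimodule_hom A C D"
    by (rule bimodule_homI) (simp_all add: eq bimodule_homD[OF g'(1)] C.rsmult_closed C.smult_closed)
  moreover have "tensor_map A D D g' g' (\<Delta> c) = tensor_map A D D g g (\<Delta> c)" if "c \<in> carrier C" for c
    by (rule tensor_map_cong[OF C.CC.bimodule_pair_axioms D.bimodule_pairI[OF D] g'(1) g'(1)])
      (simp_all add: eq that C.comult(1))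
  ultimately show ?thesis
    by (simp add: coring_hom_def eq g'(2,3))
qed

text \<open>Every axiom for \<open>D\<close> is checked at an element \<open>s c\<close>. Functoriality turns both sides of
  coassociativity into the image under \<open>s \<otimes> s \<otimes> s\<close> of the corresponding sides for \<open>C\<close>, and
  naturality of the associator matches the two bracketings. The counit laws reduce in the same way to
  \<open>s\<close> applied to those of \<open>C\<close>.\<close>

lemma coring_surjection:
  assumes C: "coring K A C \<Delta> \<epsilon>" and D: "bimodule K A D"
    and s: "s \<in> bimodule_hom A C D" and onto: "s ` carrier C = carrier D"
    and \<Delta>': "\<And>c. c \<in> carrier C \<Longrightarrow> \<Delta>' (s c) = tensor_map A D D s s (\<Delta> c)"
    and \<epsilon>': "\<And>c. c \<in> carrier C \<Longrightarrow> \<epsilon>' (s c) = \<epsilon> c"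
  shows "coring K A D \<Delta>' \<epsilon>'"
proof -
  interpret C: coring K A C \<Delta> \<epsilon> by fact
  interpret D: bimodule K A D by fact
  interpret DDD: bimodule_triple K A D D D ..
  note hom = bimodule_homD[OF s]
  have all: "(\<forall>x \<in> carrier D. Q x) \<longleftrightarrow> (\<forall>c \<in> carrier C. Q (s c))" for Q
    by (simp add: onto[symmetric])
  note CC = C.CC.bimodule_pair_axioms and DD = DDD.MN.bimodule_pair_axioms
  note ss = tensor_map_hom[OF CC DD s s]
  note fold_ops = hom(2-4)[symmetric] C.rsmult_closed
  have \<Delta>'_hom: "\<Delta>' \<in> bimodule_hom A D (tensor A D D)"
    using bimodule_homD[OF ss] unfolding bimodule_hom_def Pi_iff mem_Collect_eq all
    by (simp add: fold_ops \<Delta>' C.comult)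
  have \<epsilon>'_hom: "\<epsilon>' \<in> bimodule_hom A D (regular_bimodule A)"
    unfolding bimodule_hom_def Pi_iff mem_Collect_eq all
    by (simp add: fold_ops \<epsilon>' C.counit regular_bimodule_def)
  note eps = bimodule_homD[OF \<epsilon>'_hom, unfolded regular_bimodule_def, simplified]
  have coassoc: "tensor_assoc A D D D (tensor_map A (tensor A D D) D \<Delta>' (\<lambda>x. x) (\<Delta>' (s c))) =
      tensor_map A D (tensor A D D) (\<lambda>x. x) \<Delta>' (\<Delta>' (s c))" (is "?l = ?r")
    if c: "c \<in> carrier C" for c
  proof -
    note t = C.comult(1)[OF c]
    have left: "tensor_map A (tensor A D D) D \<Delta>' (\<lambda>x. x) (\<Delta>' (s c)) =
        tensor_map A (tensor A D D) D (tensor_map A D D s s) s (tensor_map A (tensor A C C) C \<Delta> (\<lambda>x. x) (\<Delta> c))"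
    proof -
      have "tensor_map A (tensor A D D) D \<Delta>' (\<lambda>x. x) (\<Delta>' (s c)) =
          tensor_map A (tensor A D D) D (\<lambda>x. \<Delta>' (s x)) s (\<Delta> c)"
        using \<Delta>'[OF c] tensor_map_compose[OF CC DD DDD.MN_P.bimodule_pair_axioms s s \<Delta>'_hom bimodule_hom_id t]
        by simp
      also have "\<dots> = tensor_map A (tensor A D D) D (\<lambda>x. tensor_map A D D s s (\<Delta> x)) s (\<Delta> c)"
        by (rule tensor_map_cong[OF CC DDD.MN_P.bimodule_pair_axioms bimodule_hom_compose[OF C.comult_hom ss] s _ _ t])
          (simp_all add: \<Delta>')
      also have "\<dots> = tensor_map A (tensor A D D) D (tensor_map A D D s s) s
          (tensor_map A (tensor A C C) C \<Delta> (\<lambda>x. x) (\<Delta> c))"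
        using tensor_map_compose[OF CC C.CCC.MN_P.bimodule_pair_axioms DDD.MN_P.bimodule_pair_axioms
            C.comult_hom bimodule_hom_id ss s t] by simp
      finally show ?thesis .
    qed
    have right: "tensor_map A D (tensor A D D) (\<lambda>x. x) \<Delta>' (\<Delta>' (s c)) =
        tensor_map A D (tensor A D D) s (tensor_map A D D s s) (tensor_map A C (tensor A C C) (\<lambda>x. x) \<Delta> (\<Delta> c))"
    proof -
      have "tensor_map A D (tensor A D D) (\<lambda>x. x) \<Delta>' (\<Delta>' (s c)) =
          tensor_map A D (tensor A D D) s (\<lambda>x. \<Delta>' (s x)) (\<Delta> c)"
        using \<Delta>'[OF c] tensor_map_compose[OF CC DD DDD.M_NP.bimodule_pair_axioms s s bimodule_hom_id \<Delta>'_hom t]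
        by simp
      also have "\<dots> = tensor_map A D (tensor A D D) s (\<lambda>x. tensor_map A D D s s (\<Delta> x)) (\<Delta> c)"
        by (rule tensor_map_cong[OF CC DDD.M_NP.bimodule_pair_axioms s bimodule_hom_compose[OF C.comult_hom ss] _ _ t])
          (simp_all add: \<Delta>')
      also have "\<dots> = tensor_map A D (tensor A D D) s (tensor_map A D D s s)
          (tensor_map A C (tensor A C C) (\<lambda>x. x) \<Delta> (\<Delta> c))"
        using tensor_map_compose[OF CC C.CCC.M_NP.bimodule_pair_axioms DDD.M_NP.bimodule_pair_axioms
            bimodule_hom_id C.comult_hom s ss t] by simp
      finally show ?thesis .
    qed
    have "tensor_map A (tensor A C C) C \<Delta> (\<lambda>x. x) (\<Delta> c) \<in> carrier (tensor A (tensor A C C) C)"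
      by (rule tensor_map_closed[OF CC C.CCC.MN_P.bimodule_pair_axioms C.comult_hom bimodule_hom_id t])
    then show ?thesis
      unfolding left right C.coassoc[OF c, symmetric]
      by (rule tensor_assoc_natural[OF C.CCC.bimodule_triple_axioms DDD.bimodule_triple_axioms s s s])
  qed
  have left: "tensor_lift D (\<lambda>x y. \<epsilon>' x \<odot>\<^bsub>D\<^esub> y) (\<Delta>' (s c)) = s c" if c: "c \<in> carrier C" for c
  proof -
    note t = C.comult(1)[OF c]
    have b: "balanced A C C C (\<lambda>x y. \<epsilon> x \<odot>\<^bsub>C\<^esub> y)"
      by (simp add: balanced_def C.counit C.smult_l_distr C.smult_r_distr C.smult_assoc1)
    have b': "balanced A D D D (\<lambda>x y. \<epsilon>' x \<odot>\<^bsub>D\<^esub> y)"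
      by (simp add: balanced_def eps D.smult_l_distr D.smult_r_distr D.smult_assoc1)
    have "tensor_lift D (\<lambda>x y. \<epsilon>' x \<odot>\<^bsub>D\<^esub> y) (\<Delta>' (s c)) = tensor_lift D (\<lambda>x y. \<epsilon>' (s x) \<odot>\<^bsub>D\<^esub> s y) (\<Delta> c)"
      by (simp add: \<Delta>' c tensor_lift_tensor_map[OF CC DD s s D.M.abelian_group_axioms b' t])
    also have "\<dots> = tensor_lift D (\<lambda>x y. s (\<epsilon> x \<odot>\<^bsub>C\<^esub> y)) (\<Delta> c)"
      by (rule C.CC.tensor_lift_cong[OF D.M.abelian_group_axioms _ _ t])
        (use b in \<open>simp_all add: balanced_def hom \<epsilon>' C.counit\<close>)
    also have "\<dots> = s (tensor_lift C (\<lambda>x y. \<epsilon> x \<odot>\<^bsub>C\<^esub> y) (\<Delta> c))"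
      using C.CC.additive_tensor_lift[OF C.M.abelian_group_axioms b D.M.abelian_group_axioms hom(1,2) t] by simp
    finally show ?thesis using C.counit_left[OF c] by simp
  qed
  have right: "tensor_lift D (\<lambda>x y. x \<triangleleft>\<^bsub>D\<^esub> \<epsilon>' y) (\<Delta>' (s c)) = s c" if c: "c \<in> carrier C" for c
  proof -
    note t = C.comult(1)[OF c]
    have b: "balanced A C C C (\<lambda>x y. x \<triangleleft>\<^bsub>C\<^esub> \<epsilon> y)"
      by (simp add: balanced_def C.counit C.rsmult_closed C.rsmult_l_distr C.rsmult_r_distr C.rsmult_assoc)
    have b': "balanced A D D D (\<lambda>x y. x \<triangleleft>\<^bsub>D\<^esub> \<epsilon>' y)"
      by (simp add: balanced_def eps D.rsmult_closed D.rsmult_l_distr D.rsmult_r_distr D.rsmult_assoc)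
    have "tensor_lift D (\<lambda>x y. x \<triangleleft>\<^bsub>D\<^esub> \<epsilon>' y) (\<Delta>' (s c)) = tensor_lift D (\<lambda>x y. s x \<triangleleft>\<^bsub>D\<^esub> \<epsilon>' (s y)) (\<Delta> c)"
      by (simp add: \<Delta>' c tensor_lift_tensor_map[OF CC DD s s D.M.abelian_group_axioms b' t])
    also have "\<dots> = tensor_lift D (\<lambda>x y. s (x \<triangleleft>\<^bsub>C\<^esub> \<epsilon> y)) (\<Delta> c)"
      by (rule C.CC.tensor_lift_cong[OF D.M.abelian_group_axioms _ _ t])
        (use b in \<open>simp_all add: balanced_def hom \<epsilon>' C.counit D.rsmult_closed\<close>)
    also have "\<dots> = s (tensor_lift C (\<lambda>x y. x \<triangleleft>\<^bsub>C\<^esub> \<epsilon> y) (\<Delta> c))"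
      using C.CC.additive_tensor_lift[OF C.M.abelian_group_axioms b D.M.abelian_group_axioms hom(1,2) t] by simp
    finally show ?thesis using C.counit_right[OF c] by simp
  qed
  show ?thesis
    by (intro coring.intro coring_axioms.intro D \<Delta>'_hom \<epsilon>'_hom)
      (use coassoc left right in \<open>auto simp flip: onto\<close>)
qed

text \<open>The bimodule structure on the image of \<open>s\<close> that makes an injective \<open>s\<close> an isomorphism.\<close>

definition transport :: "('b \<Rightarrow> 'c) \<Rightarrow> ('a, 'b, 'o) bimodule_scheme \<Rightarrow> ('a, 'c) bimodule"
  where "transport s M = (let r = inv_into (carrier M) s in
    \<lparr>carrier = s ` carrier M, monoid.mult = undefined, one = undefined,
     ring.zero = s \<zero>\<^bsub>M\<^esub>, ring.add = (\<lambda>x y. s (r x \<oplus>\<^bsub>M\<^esub> r y)),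
     smult = (\<lambda>a x. s (a \<odot>\<^bsub>M\<^esub> r x)), rsmult = (\<lambda>x a. s (r x \<triangleleft>\<^bsub>M\<^esub> a))\<rparr>)"

lemma coring_transport:
  assumes C: "coring K A C \<Delta> \<epsilon>" and inj: "inj_on s (carrier C)"
  obtains \<Delta>' \<epsilon>' where "coring K A (transport s C) \<Delta>' \<epsilon>'"
    and "s \<in> coring_hom A C \<Delta> \<epsilon> (transport s C) \<Delta>' \<epsilon>'"
proof -
  interpret C: coring K A C \<Delta> \<epsilon> by fact
  define D where "D = transport s C"
  define r where "r = inv_into (carrier C) s"
  have r: "r (s c) = c" if "c \<in> carrier C" for c
    using inj that by (simp add: r_def)
  have s: "s \<in> bimodule_hom A C D"
    by (rule bimodule_homI)
      (simp_all add: D_def transport_def Let_def inv_into_f_f[OF inj] C.rsmult_closed)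
  have onto: "s ` carrier C = carrier D" and zero: "s \<zero>\<^bsub>C\<^esub> = \<zero>\<^bsub>D\<^esub>"
    by (simp_all add: D_def transport_def Let_def)
  have D: "bimodule K A D"
    by (rule bimodule_surjection[OF C.bimodule_axioms s onto zero])
  have "coring K A D (\<lambda>d. tensor_map A D D s s (\<Delta> (r d))) (\<lambda>d. \<epsilon> (r d))"
    by (rule coring_surjection[OF C D s onto]) (simp_all add: r)
  moreover have "s \<in> coring_hom A C \<Delta> \<epsilon> D (\<lambda>d. tensor_map A D D s s (\<Delta> (r d))) (\<lambda>d. \<epsilon> (r d))"
    using s by (simp add: coring_hom_def r)
  ultimately show thesis
    using that unfolding D_def by blast
qed

section \<open>Quotients by coideals\<close>

lemma subbimodule_zero:
  assumes "bimodule K A M"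
  shows "subbimodule A M {\<zero>\<^bsub>M\<^esub>}"
proof -
  interpret bimodule K A M by fact
  have "\<zero>\<^bsub>M\<^esub> \<triangleleft>\<^bsub>M\<^esub> a = \<zero>\<^bsub>M\<^esub>" if "a \<in> carrier A" for a
    using rsmult_l_distr[of "\<zero>\<^bsub>M\<^esub>" "\<zero>\<^bsub>M\<^esub>" a] rsmult_closed[of "\<zero>\<^bsub>M\<^esub>" a] that
    by (metis M.add.r_cancel_one' M.l_zero M.zero_closed)
  then show ?thesis
    unfolding subbimodule_def by (auto intro!: submoduleI)
qed

text \<open>The projection onto \<open>C/0\<close> is the bijection \<open>c \<mapsto> {c}\<close>, along which the coring structure of \<open>C\<close>
  is carried over.\<close>

lemma coideal_zero:
  assumes C: "coring K A C \<Delta> \<epsilon>"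
  shows "coideal K A C \<Delta> \<epsilon> {\<zero>\<^bsub>C\<^esub>}"
proof -
  interpret C: coring K A C \<Delta> \<epsilon> by fact
  define Q where "Q = quotient_bimodule C {\<zero>\<^bsub>C\<^esub>}"
  define p where "p = (\<lambda>c. {\<zero>\<^bsub>C\<^esub>} +>\<^bsub>C\<^esub> c)"
  have p: "p c = {c}" if "c \<in> carrier C" for c
    using that by (simp add: p_def a_r_coset_def')
  have carrier: "carrier Q = p ` carrier C"
    by (auto simp: Q_def quotient_bimodule_def A_RCOSETS_def' p_def a_r_coset_def')
  have p_hom: "p \<in> bimodule_hom A C Q"
    by (rule bimodule_homI)
      (auto simp: carrier p C.rsmult_closed,
        simp_all add: Q_def quotient_bimodule_def set_add_def' fun_cong[OF p_def, symmetric] p C.rsmult_closed)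
  have Q: "bimodule K A Q"
    by (rule bimodule_surjection[OF C.bimodule_axioms p_hom carrier[symmetric]])
      (simp add: p, simp add: Q_def quotient_bimodule_def)
  have cQ: "coring K A Q (\<lambda>q. tensor_map A Q Q p p (\<Delta> (the_elem q))) (\<lambda>q. \<epsilon> (the_elem q))"
    by (rule coring_surjection[OF C Q p_hom carrier[symmetric]]) (simp_all add: p)
  have "p \<in> coring_hom A C \<Delta> \<epsilon> Q (\<lambda>q. tensor_map A Q Q p p (\<Delta> (the_elem q))) (\<lambda>q. \<epsilon> (the_elem q))"
    using p_hom by (simp add: coring_hom_def p)
  then show ?thesis
    unfolding coideal_def using subbimodule_zero[OF C.bimodule_axioms] cQ
    unfolding Q_def p_def by blast
qed

text \<open>A copy of the quotient coring whose carrier consists of chosen coset representatives and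
  hence lives in the type of \<open>C\<close>. Here \<open>\<rho>\<close> sends an element to the representative of its coset.\<close>

lemma coideal_quotient_on_representatives:
  fixes C :: "('a, 'c, 'o) bimodule_scheme"
  assumes C: "coring K A C \<Delta> \<epsilon>" and J: "coideal K A C \<Delta> \<epsilon> J"
  obtains D :: "('a, 'c) bimodule" and \<Delta>' \<epsilon>' \<rho>
  where "coring K A D \<Delta>' \<epsilon>'" and "\<rho> \<in> coring_hom A C \<Delta> \<epsilon> D \<Delta>' \<epsilon>'" and "\<rho> ` carrier C = carrier D"
    and "\<And>c. c \<in> carrier C \<Longrightarrow> \<rho> c \<in> carrier C \<and> (\<exists>j \<in> J. \<rho> c = j \<oplus>\<^bsub>C\<^esub> c)"
    and "\<And>j. j \<in> J \<Longrightarrow> \<rho> j = \<rho> \<zero>\<^bsub>C\<^esub>"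
proof -
  interpret C: coring K A C \<Delta> \<epsilon> by fact
  define Q where "Q = quotient_bimodule C J"
  define p where "p = (\<lambda>c. J +>\<^bsub>C\<^esub> c)"
  define s :: "'c set \<Rightarrow> 'c" where "s = (\<lambda>q. SOME c. c \<in> q)"
  have sub: "subgroup J (add_monoid C)"
    using J by (simp add: coideal_def subbimodule_def submodule_def)
  obtain \<Delta>Q \<epsilon>Q where Q: "coring K A Q \<Delta>Q \<epsilon>Q" and p: "p \<in> coring_hom A C \<Delta> \<epsilon> Q \<Delta>Q \<epsilon>Q"
    using J unfolding coideal_def Q_def p_def by blast
  have carrier: "carrier Q = p ` carrier C"
    by (auto simp: Q_def quotient_bimodule_def A_RCOSETS_def' p_def a_r_coset_def')
  have self: "c \<in> p c" if "c \<in> carrier C" for c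
    using C.add.rcos_self[OF _ sub, of c] that by (simp add: p_def a_r_coset_def)
  have sp: "s (p c) \<in> p c" if "c \<in> carrier C" for c
    unfolding s_def by (rule someI[where P = "\<lambda>x. x \<in> p c", OF self[OF that]])
  have psp: "p (s (p c)) = p c" if "c \<in> carrier C" for c
    using C.M.a_repr_independence[OF sp[OF that, unfolded p_def] that sub] by (simp add: p_def)
  have inj: "inj_on s (carrier Q)"
    unfolding carrier by (rule inj_on_inverseI[of _ p]) (auto simp: psp)
  obtain \<Delta>' \<epsilon>' where D: "coring K A (transport s Q) \<Delta>' \<epsilon>'"
    and s: "s \<in> coring_hom A Q \<Delta>Q \<epsilon>Q (transport s Q) \<Delta>' \<epsilon>'"
    by (rule coring_transport[OF Q inj])
  show thesis
  proof
    show "coring K A (transport s Q) \<Delta>' \<epsilon>'" by fact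
    show "(\<lambda>c. s (p c)) \<in> coring_hom A C \<Delta> \<epsilon> (transport s Q) \<Delta>' \<epsilon>'"
      by (rule coring_hom_compose[OF C Q D p s])
    show "(\<lambda>c. s (p c)) ` carrier C = carrier (transport s Q)"
      by (auto simp: transport_def Let_def carrier)
    fix c assume c: "c \<in> carrier C"
    obtain j where "j \<in> J" "s (p c) = j \<oplus>\<^bsub>C\<^esub> c"
      using sp[OF c] by (auto simp: p_def a_r_coset_def')
    then show "s (p c) \<in> carrier C \<and> (\<exists>j \<in> J. s (p c) = j \<oplus>\<^bsub>C\<^esub> c)"
      using c subgroup.subset[OF sub] by auto
  next
    fix j assume j: "j \<in> J"
    have "j \<in> p \<zero>\<^bsub>C\<^esub>"
      using j subgroup.subset[OF sub] by (auto simp: p_def a_r_coset_def' intro!: bexI[of _ j])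
    then show "s (p j) = s (p \<zero>\<^bsub>C\<^esub>)"
      using C.M.a_repr_independence[of j J "\<zero>\<^bsub>C\<^esub>"] sub by (simp add: p_def)
  qed
qed

section \<open>Coideals in the kernel of the universal map\<close>

text \<open>The right-hand side of the first dual relation is induced on the tensor product by this map. It
  is balanced because \<open>f (z a) r = f z (a r)\<close> and \<open>f (a z) x = a (f z x)\<close>: both sides become
  \<open>f z\<^sub>1 (a f(z\<^sub>2)(x) y)\<close>.\<close>

lemma (in A_ring) balanced_dual_relation:
  assumes C: "bimodule K A C" and f: "f \<in> bimodule_hom A C (right_dual A R \<iota>)"
    and x: "x \<in> carrier R" and y: "y \<in> carrier R"
  shows "balanced A C C A (\<lambda>z\<^sub>1 z\<^sub>2. f z\<^sub>1 (\<iota> (f z\<^sub>2 x) \<otimes>\<^bsub>R\<^esub> y))"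
proof -
  interpret C: bimodule K A C by fact
  interpret \<iota>: ring_hom_ring A R \<iota>
    using ring_hom cring.axioms(1)[OF A.M_cring] B.S.ring_axioms by (simp add: ring_hom_ringI2)
  have f_closed: "f z r \<in> carrier A" if "z \<in> carrier C" "r \<in> carrier R" for z r
    using bimodule_homD(1)[OF f that(1)] that(2) by (auto simp: right_dual_def)
  have f_add: "f z (r \<oplus>\<^bsub>R\<^esub> r') = f z r \<oplus>\<^bsub>A\<^esub> f z r'"
    if "z \<in> carrier C" "r \<in> carrier R" "r' \<in> carrier R" for z r r'
    using bimodule_homD(1)[OF f that(1)] that(2,3) by (auto simp: right_dual_def)
  have f_plus: "f (z \<oplus>\<^bsub>C\<^esub> z') r = f z r \<oplus>\<^bsub>A\<^esub> f z' r"
    if "z \<in> carrier C" "z' \<in> carrier C" "r \<in> carrier R" for z z' r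
    using bimodule_homD(2)[OF f that(1,2)] that(3) by (simp add: right_dual_def)
  have f_smult: "f (a \<odot>\<^bsub>C\<^esub> z) r = a \<otimes>\<^bsub>A\<^esub> f z r"
    if "a \<in> carrier A" "z \<in> carrier C" "r \<in> carrier R" for a z r
    using bimodule_homD(3)[OF f that(1,2)] that(3) by (simp add: right_dual_def)
  have f_rsmult: "f (z \<triangleleft>\<^bsub>C\<^esub> a) r = f z (\<iota> a \<otimes>\<^bsub>R\<^esub> r)"
    if "a \<in> carrier A" "z \<in> carrier C" "r \<in> carrier R" for a z r
    using bimodule_homD(4)[OF f that(1,2)] that(3) by (simp add: right_dual_def)
  show ?thesis
    using x y
    by (simp add: balanced_def f_closed f_add f_plus f_smult f_rsmult B.S.l_distr B.S.m_assoc)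
qed

lemma bimodule_hom_descend:
  assumes C: "bimodule K A C" and \<rho>: "\<rho> \<in> bimodule_hom A C D" and onto: "\<rho> ` carrier C = carrier D"
    and h: "h \<in> bimodule_hom A C N" and f: "\<And>c. c \<in> carrier C \<Longrightarrow> f (\<rho> c) = h c"
  shows "f \<in> bimodule_hom A D N"
proof -
  interpret C: bimodule K A C by fact
  have all: "(\<forall>x \<in> carrier D. Q x) \<longleftrightarrow> (\<forall>c \<in> carrier C. Q (\<rho> c))" for Q
    by (simp add: onto[symmetric])
  show ?thesis
    unfolding bimodule_hom_def Pi_iff mem_Collect_eq all
    by (simp add: bimodule_homD(2-4)[OF \<rho>, symmetric] f bimodule_homD[OF h] C.rsmult_closed)
qed

text \<open>The relations at \<open>\<rho> c\<close> are those of \<open>h = f \<circ> \<rho>\<close> at \<open>c\<close>, because \<open>\<rho>\<close> commutes with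
  comultiplication and counit; surjectivity of \<open>\<rho>\<close> then gives them everywhere.\<close>

lemma (in A_ring) dual_relations_descend:
  assumes C: "coring K A C \<Delta> \<epsilon>" and D: "coring K A D \<Delta>' \<epsilon>'"
    and \<rho>: "\<rho> \<in> coring_hom A C \<Delta> \<epsilon> D \<Delta>' \<epsilon>'" and onto: "\<rho> ` carrier C = carrier D"
    and f: "f \<in> bimodule_hom A D (right_dual A R \<iota>)"
    and h: "\<And>c. c \<in> carrier C \<Longrightarrow> f (\<rho> c) = h c" and rel: "dual_relations A R \<iota> C \<Delta> \<epsilon> h"
  shows "dual_relations A R \<iota> D \<Delta>' \<epsilon>' f"
proof -
  interpret C: coring K A C \<Delta> \<epsilon> by fact
  interpret D: coring K A D \<Delta>' \<epsilon>' by fact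
  note \<rho>' = coring_homD[OF \<rho>]
  note CC = C.CC.bimodule_pair_axioms and DD = D.CC.bimodule_pair_axioms
  have all: "(\<forall>x \<in> carrier D. Q x) \<longleftrightarrow> (\<forall>c \<in> carrier C. Q (\<rho> c))" for Q
    by (simp add: onto[symmetric])
  have A: "abelian_group A" by (rule A.M.abelian_group_axioms)
  have "f (\<rho> c) (x \<otimes>\<^bsub>R\<^esub> y) = tensor_lift A (\<lambda>z\<^sub>1 z\<^sub>2. f z\<^sub>1 (\<iota> (f z\<^sub>2 x) \<otimes>\<^bsub>R\<^esub> y)) (\<Delta>' (\<rho> c))"
    if c: "c \<in> carrier C" and x: "x \<in> carrier R" and y: "y \<in> carrier R" for c x y
  proof -
    note b = balanced_dual_relation[OF D.bimodule_axioms f x y]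
    note t = C.comult(1)[OF c]
    have "f (\<rho> c) (x \<otimes>\<^bsub>R\<^esub> y) = tensor_lift A (\<lambda>z\<^sub>1 z\<^sub>2. h z\<^sub>1 (\<iota> (h z\<^sub>2 x) \<otimes>\<^bsub>R\<^esub> y)) (\<Delta> c)"
      using rel c x y by (simp add: dual_relations_def h)
    also have "\<dots> = tensor_lift A (\<lambda>z\<^sub>1 z\<^sub>2. f (\<rho> z\<^sub>1) (\<iota> (f (\<rho> z\<^sub>2) x) \<otimes>\<^bsub>R\<^esub> y)) (\<Delta> c)"
      by (rule C.CC.tensor_lift_cong[OF A balanced_comp_hom[OF CC DD \<rho>'(1) \<rho>'(1) b] _ t]) (simp add: h)
    also have "\<dots> = tensor_lift A (\<lambda>z\<^sub>1 z\<^sub>2. f z\<^sub>1 (\<iota> (f z\<^sub>2 x) \<otimes>\<^bsub>R\<^esub> y)) (\<Delta>' (\<rho> c))"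
      using tensor_lift_tensor_map[OF CC DD \<rho>'(1) \<rho>'(1) A b t] \<rho>'(2)[OF c] by simp
    finally show ?thesis .
  qed
  then show ?thesis
    using rel unfolding dual_relations_def all
    by (simp add: h \<rho>'(3) bimodule_homD(3,4)[OF \<rho>'(1), symmetric] C.rsmult_closed)
qed

text \<open>The descent of \<open>\<xi>\<close> to the quotient by \<open>J\<close> lifts back to \<open>g\<close>, and uniqueness forces
  \<open>g \<circ> \<rho>\<close> to be the identity. Since \<open>\<rho>\<close> collapses \<open>J\<close>, it follows that \<open>J\<close> is zero.\<close>

lemma coideal_in_kernel_trivial:
  fixes C :: "('a, 'c) bimodule"
  assumes R: "A_ring K A R \<iota>" and fd: "finite_dual K A R \<iota> C \<Delta> \<epsilon> \<xi>"
    and J: "coideal K A C \<Delta> \<epsilon> J" and ker: "J \<subseteq> a_kernel C (right_dual A R \<iota>) \<xi>"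
  shows "J = {\<zero>\<^bsub>C\<^esub>}"
proof -
  have C: "coring K A C \<Delta> \<epsilon>" and \<xi>: "\<xi> \<in> bimodule_hom A C (right_dual A R \<iota>)"
    and rel: "dual_relations A R \<iota> C \<Delta> \<epsilon> \<xi>"
    and univ: "\<And>(D :: ('a, 'c) bimodule) \<Delta>' \<epsilon>' f.
      \<lbrakk>coring K A D \<Delta>' \<epsilon>'; f \<in> bimodule_hom A D (right_dual A R \<iota>); dual_relations A R \<iota> D \<Delta>' \<epsilon>' f\<rbrakk>
      \<Longrightarrow> \<exists>!g. g \<in> extensional (carrier D) \<and> g \<in> coring_hom A D \<Delta>' \<epsilon>' C \<Delta> \<epsilon> \<and>
        (\<forall>z \<in> carrier D. \<xi> (g z) = f z)"
    using fd unfolding finite_dual_def by blast+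
  interpret C: coring K A C \<Delta> \<epsilon> by (rule C)
  interpret R: A_ring K A R \<iota> by (rule R)
  obtain D :: "('a, 'c) bimodule" and \<Delta>' \<epsilon>' \<rho>
    where D: "coring K A D \<Delta>' \<epsilon>'" and \<rho>: "\<rho> \<in> coring_hom A C \<Delta> \<epsilon> D \<Delta>' \<epsilon>'"
      and onto: "\<rho> ` carrier C = carrier D"
      and rep: "\<And>c. c \<in> carrier C \<Longrightarrow> \<rho> c \<in> carrier C \<and> (\<exists>j \<in> J. \<rho> c = j \<oplus>\<^bsub>C\<^esub> c)"
      and \<rho>_J: "\<And>j. j \<in> J \<Longrightarrow> \<rho> j = \<rho> \<zero>\<^bsub>C\<^esub>"
    by (rule coideal_quotient_on_representatives[OF C J]) (rule that)
  have \<xi>\<rho>: "\<xi> (\<rho> c) = \<xi> c" if c: "c \<in> carrier C" for c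
  proof -
    obtain j where j: "j \<in> J" "\<rho> c = j \<oplus>\<^bsub>C\<^esub> c" using rep[OF c] by blast
    have j0: "j \<in> carrier C" "\<xi> j = \<zero>\<^bsub>right_dual A R \<iota>\<^esub>"
      using j(1) ker by (auto simp: a_kernel_def')
    have "\<xi> c \<in> carrier R \<rightarrow>\<^sub>E carrier A"
      using bimodule_homD(1)[OF \<xi> c] by (simp add: right_dual_def)
    then show ?thesis
      unfolding j(2) bimodule_homD(2)[OF \<xi> j0(1) c] j0(2)
      by (auto simp: right_dual_def fun_eq_iff PiE_iff extensional_def)
  qed
  have \<xi>D: "\<xi> \<in> bimodule_hom A D (right_dual A R \<iota>)"
    by (rule bimodule_hom_descend[OF C.bimodule_axioms coring_homD(1)[OF \<rho>] onto \<xi> \<xi>\<rho>])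
  have "dual_relations A R \<iota> D \<Delta>' \<epsilon>' \<xi>"
    by (rule R.dual_relations_descend[OF C D \<rho> onto \<xi>D \<xi>\<rho> rel])
  from univ[OF D \<xi>D this] obtain g where g: "g \<in> coring_hom A D \<Delta>' \<epsilon>' C \<Delta> \<epsilon>"
    and \<xi>g: "\<And>z. z \<in> carrier D \<Longrightarrow> \<xi> (g z) = \<xi> z" by blast
  have g\<rho>: "g (\<rho> c) = c" if c: "c \<in> carrier C" for c
  proof -
    \<comment> \<open>Uniqueness concerns maps that are extensional on the carrier, hence the restrictions.\<close>
    have 1: "(\<lambda>c \<in> carrier C. g (\<rho> c)) \<in> coring_hom A C \<Delta> \<epsilon> C \<Delta> \<epsilon>"
      by (rule coring_hom_cong[OF C C.bimodule_axioms coring_hom_compose[OF C D C \<rho> g]]) simp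
    have 2: "(\<lambda>c \<in> carrier C. c) \<in> coring_hom A C \<Delta> \<epsilon> C \<Delta> \<epsilon>"
      by (rule coring_hom_cong[OF C C.bimodule_axioms coring_hom_id[OF C]]) simp
    have 3: "\<rho> z \<in> carrier D" if "z \<in> carrier C" for z
      using onto that by blast
    have "(\<lambda>c \<in> carrier C. g (\<rho> c)) = (\<lambda>c \<in> carrier C. c)"
      using univ[OF C \<xi> rel]
    proof (rule Uniq_D[OF ex1_iff_ex_Uniq[THEN iffD1, THEN conjunct2]])
      show "(\<lambda>c \<in> carrier C. g (\<rho> c)) \<in> extensional (carrier C) \<and>
          (\<lambda>c \<in> carrier C. g (\<rho> c)) \<in> coring_hom A C \<Delta> \<epsilon> C \<Delta> \<epsilon> \<and>
          (\<forall>z \<in> carrier C. \<xi> ((\<lambda>c \<in> carrier C. g (\<rho> c)) z) = \<xi> z)"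
        using 1 3 \<xi>g \<xi>\<rho> by simp
      show "(\<lambda>c \<in> carrier C. c) \<in> extensional (carrier C) \<and>
          (\<lambda>c \<in> carrier C. c) \<in> coring_hom A C \<Delta> \<epsilon> C \<Delta> \<epsilon> \<and>
          (\<forall>z \<in> carrier C. \<xi> ((\<lambda>c \<in> carrier C. c) z) = \<xi> z)"
        using 2 by simp
    qed
    then show ?thesis
      using c by (metis restrict_apply')
  qed
  have sub: "subgroup J (add_monoid C)"
    using J by (simp add: coideal_def subbimodule_def submodule_def)
  have "j = \<zero>\<^bsub>C\<^esub>" if "j \<in> J" for j
    using g\<rho>[of j] g\<rho>[of "\<zero>\<^bsub>C\<^esub>"] \<rho>_J[OF that] subgroup.subset[OF sub] that by auto
  moreover have "\<zero>\<^bsub>C\<^esub> \<in> J"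
    using subgroup.one_closed[OF sub] by simp
  ultimately show ?thesis by blast
qed

text \<open>Values of \<open>\<xi>\<close> are compared pointwise, where the cancellation takes place in \<open>A\<close>; this avoids
  establishing that the right dual is a group.\<close>

lemma inj_on_iff_kernel_zero:
  assumes C: "bimodule K A C" and \<xi>: "\<xi> \<in> bimodule_hom A C (right_dual A R \<iota>)"
  shows "inj_on \<xi> (carrier C) \<longleftrightarrow> a_kernel C (right_dual A R \<iota>) \<xi> = {\<zero>\<^bsub>C\<^esub>}"
proof -
  interpret C: bimodule K A C by (rule C)
  have closed: "\<xi> z r \<in> carrier A" if "z \<in> carrier C" "r \<in> carrier R" for z r
    using bimodule_homD(1)[OF \<xi> that(1)] that(2) by (auto simp: right_dual_def)
  have ext: "\<xi> z \<in> extensional (carrier R)" if "z \<in> carrier C" for z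
    using bimodule_homD(1)[OF \<xi> that] by (auto simp: right_dual_def PiE_def)
  have plus: "\<xi> (z \<oplus>\<^bsub>C\<^esub> z') r = \<xi> z r \<oplus>\<^bsub>A\<^esub> \<xi> z' r"
    if "z \<in> carrier C" "z' \<in> carrier C" "r \<in> carrier R" for z z' r
    using bimodule_homD(2)[OF \<xi> that(1,2)] that(3) by (simp add: right_dual_def)
  have cancel: "\<xi> z = \<zero>\<^bsub>right_dual A R \<iota>\<^esub>"
    if z: "z \<in> carrier C" "w \<in> carrier C" and eq: "\<xi> (z \<oplus>\<^bsub>C\<^esub> w) = \<xi> w" for z w
  proof -
    have "\<xi> z r = \<zero>\<^bsub>A\<^esub>" if "r \<in> carrier R" for r
      using plus[OF z that, unfolded eq] closed[OF z(1) that] closed[OF z(2) that]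
      by (simp add: C.A.M.add.r_cancel_one')
    then show ?thesis
      using ext[OF z(1)] by (auto simp: right_dual_def fun_eq_iff extensional_def)
  qed
  have \<xi>0: "\<xi> \<zero>\<^bsub>C\<^esub> = \<zero>\<^bsub>right_dual A R \<iota>\<^esub>"
    by (rule cancel[of _ "\<zero>\<^bsub>C\<^esub>"]) simp_all
  show ?thesis
  proof
    assume inj: "inj_on \<xi> (carrier C)"
    have "z = \<zero>\<^bsub>C\<^esub>" if "z \<in> a_kernel C (right_dual A R \<iota>) \<xi>" for z
      using inj_onD[OF inj, of z "\<zero>\<^bsub>C\<^esub>"] that \<xi>0 by (simp add: a_kernel_def')
    moreover have "\<zero>\<^bsub>C\<^esub> \<in> a_kernel C (right_dual A R \<iota>) \<xi>"
      using \<xi>0 by (simp add: a_kernel_def')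
    ultimately show "a_kernel C (right_dual A R \<iota>) \<xi> = {\<zero>\<^bsub>C\<^esub>}" by blast
  next
    assume ker: "a_kernel C (right_dual A R \<iota>) \<xi> = {\<zero>\<^bsub>C\<^esub>}"
    show "inj_on \<xi> (carrier C)"
    proof (rule inj_onI)
      fix x y assume xy: "x \<in> carrier C" "y \<in> carrier C" "\<xi> x = \<xi> y"
      have xyy: "(x \<ominus>\<^bsub>C\<^esub> y) \<oplus>\<^bsub>C\<^esub> y = x"
        using xy by (simp add: a_minus_def C.M.a_assoc C.M.l_neg)
      then have "\<xi> (x \<ominus>\<^bsub>C\<^esub> y) = \<zero>\<^bsub>right_dual A R \<iota>\<^esub>"
        using xy by (intro cancel[of _ y]) simp_all
      then have "x \<ominus>\<^bsub>C\<^esub> y \<in> a_kernel C (right_dual A R \<iota>) \<xi>"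
        using xy by (simp add: a_kernel_def')
      then have "x \<ominus>\<^bsub>C\<^esub> y = \<zero>\<^bsub>C\<^esub>"
        unfolding ker by simp
      then show "x = y" using xyy xy by simp
    qed
  qed
qed

theorem lemma4p4:
  fixes K :: "('k, 'm) ring_scheme"
    and A :: "('k, 'a, 'n) module_scheme"
    and R :: "('k, 'r, 'o) module_scheme"
    and \<iota> :: "'a \<Rightarrow> 'r"
    and C :: "('a, 'c) bimodule"
    and \<Delta> :: "'c \<Rightarrow> ('c, 'c) tens"
    and \<epsilon> :: "'c \<Rightarrow> 'a"
    and \<xi> :: "'c \<Rightarrow> 'r \<Rightarrow> 'a"
  assumes "field K"
    and "algebra K A"
    and "A_ring K A R \<iota>"
    and "finite_dual K A R \<iota> C \<Delta> \<epsilon> \<xi>"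
  shows "(\<forall>J. coideal K A C \<Delta> \<epsilon> J \<and> J \<subseteq> a_kernel C (right_dual A R \<iota>) \<xi> \<longrightarrow> J = {\<zero>\<^bsub>C\<^esub>}) \<and>
    (inj_on \<xi> (carrier C) \<longleftrightarrow> coideal K A C \<Delta> \<epsilon> (a_kernel C (right_dual A R \<iota>) \<xi>))"
proof -
  have C: "coring K A C \<Delta> \<epsilon>" and \<xi>: "\<xi> \<in> bimodule_hom A C (right_dual A R \<iota>)"
    using assms(4) by (simp_all add: finite_dual_def)
  have trivial: "J = {\<zero>\<^bsub>C\<^esub>}"
    if "coideal K A C \<Delta> \<epsilon> J" "J \<subseteq> a_kernel C (right_dual A R \<iota>) \<xi>" for J
    by (rule coideal_in_kernel_trivial[OF assms(3,4) that])
  have "inj_on \<xi> (carrier C) \<longleftrightarrow> coideal K A C \<Delta> \<epsilon> (a_kernel C (right_dual A R \<iota>) \<xi>)"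
    using inj_on_iff_kernel_zero[OF coring.axioms(1)[OF C] \<xi>] coideal_zero[OF C] trivial by auto
  with trivial show ?thesis by blast
qed

end
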